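(* Let $1<p<\infty$ and let $X$ be a Banach space. The following are equivalent: (1) $X$ has the $DPP_{p}$; (2) every weakly compact operator $T$ from $X$ into $c_{0}$ is unconditionally $p$-converging; (3) $\lim_{n\to\infty}\langle x^{*}_{n},x_{n}\rangle=0$ for every weakly $p$-Cauchy sequence $(x_{n})_{n}$ in $X$ and every weakly null sequence $(x^{*}_{n})_{n}$ in $X^{*}$; (4) $\lim_{n\to\infty}\langle x^{*}_{n},x_{n}\rangle=0$ for every $(x_{n})_{n}\in l^{w}_{p}(X)$ and every weakly null sequence $(x^{*}_{n})_{n}$ in $X^{*}$; (5) $\lim_{n\to\infty}\langle x^{*}_{n},x_{n}\rangle=0$ for every $(x_{n})_{n}\in l^{w}_{p}(X)$ and every weakly Cauchy sequence $(x^{*}_{n})_{n}$ in $X^{*}$.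
   Context: Banach spaces are real or complex; an operator is a continuous linear map; $B_{X^{*}}$ is the closed unit ball of $X^{*}$. A sequence $(x_n)_n$ in $X$ is weakly $p$-summable, written $(x_n)_n\in l_p^w(X)$, if $\sup\{(\sum_{n=1}^{\infty}|\langle x^*,x_n\rangle|^p)^{1/p}:x^*\in B_{X^*}\}<\infty$; it is unconditionally $p$-summable, written $(x_n)_n\in l_p^u(X)$, if moreover $\sup\{(\sum_{n=m}^{\infty}|\langle x^*,x_n\rangle|^p)^{1/p}:x^*\in B_{X^*}\}\to 0$ as $m\to\infty$. An operator $T:X\to Y$ is unconditionally $p$-converging if $(Tx_n)_n\in l_p^u(Y)$ for every $(x_n)_n\in l_p^w(X)$. An operator $T:X\to Y$ is weakly compact if $T(B_X)$ is relatively weakly compact in $Y$. $X$ has the Dunford-Pettis property of order $p$ ($DPP_p$) if for every Banach space $Y$, every weakly compact operator $T:X\to Y$ is unconditionally $p$-converging. A sequence $(x_n)_n$ is weakly $p$-Cauchy if for each pair of strictly increasing sequences $(k_n)_n$, $(j_n)_n$ of positive integers, $(x_{k_n}-x_{j_n})_n$ is weakly $p$-summable. *)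

theory Defs
  imports "HOL-Analysis.Analysis" "HOL-Algebra.Module"
begin

text \<open>
  Up to isometric isomorphism, the scalar fields are exactly \<open>real\<close> and \<open>complex\<close>, so that
  the real and the complex theory are treated at once.
\<close>

class scalar_field = real_normed_field +
  assumes real_or_complex:
    "\<exists>\<phi>::'a \<Rightarrow> complex.
       (\<forall>x y. \<phi> (x + y) = \<phi> x + \<phi> y) \<and> (\<forall>x y. \<phi> (x * y) = \<phi> x * \<phi> y) \<and>
       (\<forall>r. \<phi> (scaleR r 1) = of_real r) \<and> (\<forall>x. norm (\<phi> x) = norm x) \<and>
       (range \<phi> = \<real> \<or> range \<phi> = UNIV)"

instance real :: scalar_field
  by standard (intro exI[of _ complex_of_real], auto simp: Reals_def scaleR_conv_of_real)

instance complex :: scalar_field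
  by standard (intro exI[of _ id], auto simp: scaleR_conv_of_real)

definition scalar_ring :: "'k::field ring" where
  "scalar_ring = \<lparr>carrier = UNIV, mult = (*), one = 1, zero = 0, add = (+)\<rparr>"

text \<open>
  Normed spaces are given by explicit carriers, because the Dunford-Pettis property quantifies over
  all Banach spaces and the dual of the dual is needed. The fields \<open>mult\<close> and \<open>one\<close> inherited from
  the ring record play no role.
\<close>

record ('k, 'v) nspace = "('k, 'v) module" +
  nrm :: "'v \<Rightarrow> real"

text \<open>The locale \<open>Metric_space\<close> constrains the distance also outside the carrier.\<close>

definition ndist :: "('k, 'v) nspace \<Rightarrow> 'v \<Rightarrow> 'v \<Rightarrow> real" where
  "ndist X x y = (if x \<in> carrier X \<and> y \<in> carrier X then nrm X (x \<ominus>\<^bsub>X\<^esub> y) else 0)"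

definition norm_topology :: "('k, 'v) nspace \<Rightarrow> 'v topology" where
  "norm_topology X = Metric_space.mtopology (carrier X) (ndist X)"

locale normed_space = Module.module scalar_ring X
  for X :: "('k::scalar_field, 'v) nspace" (structure) +
  assumes nrm_nonneg: "x \<in> carrier X \<Longrightarrow> 0 \<le> nrm X x"
    and nrm_eq_0_iff: "x \<in> carrier X \<Longrightarrow> nrm X x = 0 \<longleftrightarrow> x = \<zero>\<^bsub>X\<^esub>"
    and nrm_smult: "x \<in> carrier X \<Longrightarrow> nrm X (a \<odot>\<^bsub>X\<^esub> x) = norm a * nrm X x"
    and nrm_triangle: "x \<in> carrier X \<Longrightarrow> y \<in> carrier X \<Longrightarrow> nrm X (x \<oplus>\<^bsub>X\<^esub> y) \<le> nrm X x + nrm X y"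

locale banach_space = normed_space +
  assumes complete: "Metric_space.mcomplete (carrier X) (ndist X)"

definition unit_ball :: "('k, 'v) nspace \<Rightarrow> 'v set" where
  "unit_ball X = {x \<in> carrier X. nrm X x \<le> 1}"

definition operator :: "('k, 'v) nspace \<Rightarrow> ('k, 'w) nspace \<Rightarrow> ('v \<Rightarrow> 'w) \<Rightarrow> bool" where
  "operator X Y T \<longleftrightarrow>
     T \<in> carrier X \<rightarrow> carrier Y \<and>
     (\<forall>x\<in>carrier X. \<forall>y\<in>carrier X. T (x \<oplus>\<^bsub>X\<^esub> y) = T x \<oplus>\<^bsub>Y\<^esub> T y) \<and>
     (\<forall>a. \<forall>x\<in>carrier X. T (a \<odot>\<^bsub>X\<^esub> x) = a \<odot>\<^bsub>Y\<^esub> T x) \<and>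
     continuous_map (norm_topology X) (norm_topology Y) T"

definition scalar_space :: "('k::scalar_field, 'k) nspace" where
  "scalar_space =
     \<lparr>carrier = UNIV, mult = undefined, one = undefined, zero = 0, add = (+),
      smult = (*), nrm = norm\<rparr>"

text \<open>
  Functionals are made \<open>extensional\<close> (\<open>undefined\<close> off the carrier) so that equality of functionals
  is equality of functions.
\<close>

definition dual :: "('k::scalar_field, 'v) nspace \<Rightarrow> ('k, 'v \<Rightarrow> 'k) nspace" where
  "dual X =
     \<lparr>carrier = {f \<in> extensional (carrier X). operator X scalar_space f},
      mult = undefined, one = undefined,
      zero = (\<lambda>x\<in>carrier X. 0),
      add = (\<lambda>f g. \<lambda>x\<in>carrier X. f x + g x),
      smult = (\<lambda>a f. \<lambda>x\<in>carrier X. a * f x),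
      nrm = (\<lambda>f. SUP x\<in>unit_ball X. norm (f x))\<rparr>"

definition c0 :: "('k::scalar_field, nat \<Rightarrow> 'k) nspace" where
  "c0 =
     \<lparr>carrier = {x. x \<longlonglongrightarrow> 0},
      mult = undefined, one = undefined,
      zero = (\<lambda>n. 0),
      add = (\<lambda>x y n. x n + y n),
      smult = (\<lambda>a x n. a * x n),
      nrm = (\<lambda>x. SUP n. norm (x n))\<rparr>"

definition weak_topology :: "('k::scalar_field, 'v) nspace \<Rightarrow> 'v topology" where
  "weak_topology X =
     topology_generated_by {{x \<in> carrier X. f x \<in> U} | f U. f \<in> carrier (dual X) \<and> open U}"

definition weakly_null :: "('k::scalar_field, 'v) nspace \<Rightarrow> (nat \<Rightarrow> 'v) \<Rightarrow> bool" where
  "weakly_null X x \<longleftrightarrow>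
     range x \<subseteq> carrier X \<and> limitin (weak_topology X) x \<zero>\<^bsub>X\<^esub> sequentially"

definition weakly_Cauchy :: "('k::scalar_field, 'v) nspace \<Rightarrow> (nat \<Rightarrow> 'v) \<Rightarrow> bool" where
  "weakly_Cauchy X x \<longleftrightarrow>
     range x \<subseteq> carrier X \<and> (\<forall>f\<in>carrier (dual X). Cauchy (\<lambda>n. f (x n)))"

definition relatively_weakly_compact :: "('k::scalar_field, 'v) nspace \<Rightarrow> 'v set \<Rightarrow> bool" where
  "relatively_weakly_compact X S \<longleftrightarrow>
     S \<subseteq> carrier X \<and> compactin (weak_topology X) (weak_topology X closure_of S)"

definition weakly_compact_operator ::
  "('k::scalar_field, 'v) nspace \<Rightarrow> ('k, 'w) nspace \<Rightarrow> ('v \<Rightarrow> 'w) \<Rightarrow> bool" where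
  "weakly_compact_operator X Y T \<longleftrightarrow>
     operator X Y T \<and> relatively_weakly_compact Y (T ` unit_ball X)"

definition lp_norm :: "real \<Rightarrow> (nat \<Rightarrow> 'k::real_normed_vector) \<Rightarrow> real" where
  "lp_norm p a = (\<Sum>n. norm (a n) powr p) powr (1 / p)"

text \<open>
  Real-valued sums and suprema have arbitrary values when they diverge, hence the explicit
  summability and boundedness conditions.
\<close>

definition weakly_p_summable ::
  "real \<Rightarrow> ('k::scalar_field, 'v) nspace \<Rightarrow> (nat \<Rightarrow> 'v) \<Rightarrow> bool" where
  "weakly_p_summable p X x \<longleftrightarrow>
     range x \<subseteq> carrier X \<and>
     (\<forall>f\<in>unit_ball (dual X). summable (\<lambda>n. norm (f (x n)) powr p)) \<and>
     bdd_above ((\<lambda>f. lp_norm p (\<lambda>n. f (x n))) ` unit_ball (dual X))"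

definition unconditionally_p_summable ::
  "real \<Rightarrow> ('k::scalar_field, 'v) nspace \<Rightarrow> (nat \<Rightarrow> 'v) \<Rightarrow> bool" where
  "unconditionally_p_summable p X x \<longleftrightarrow>
     weakly_p_summable p X x \<and>
     (\<lambda>m. SUP f\<in>unit_ball (dual X). lp_norm p (\<lambda>n. f (x (n + m)))) \<longlonglongrightarrow> 0"

definition weakly_p_Cauchy ::
  "real \<Rightarrow> ('k::scalar_field, 'v) nspace \<Rightarrow> (nat \<Rightarrow> 'v) \<Rightarrow> bool" where
  "weakly_p_Cauchy p X x \<longleftrightarrow>
     range x \<subseteq> carrier X \<and>
     (\<forall>k j::nat \<Rightarrow> nat. strict_mono k \<longrightarrow> strict_mono j \<longrightarrow>
        weakly_p_summable p X (\<lambda>n. x (k n) \<ominus>\<^bsub>X\<^esub> x (j n)))"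

definition unconditionally_p_converging ::
  "real \<Rightarrow> ('k::scalar_field, 'v) nspace \<Rightarrow> ('k, 'w) nspace \<Rightarrow> ('v \<Rightarrow> 'w) \<Rightarrow> bool" where
  "unconditionally_p_converging p X Y T \<longleftrightarrow>
     (\<forall>x. weakly_p_summable p X x \<longrightarrow> unconditionally_p_summable p Y (\<lambda>n. T (x n)))"

text \<open>
  HOL cannot quantify over all types inside a formula, so \<open>DPP TYPE('u)\<close> lets the codomain range over
  all Banach spaces carried by subsets of \<open>(nat \<Rightarrow> 'k) + 'u\<close>. The type \<open>'u\<close> is arbitrary, and every
  Banach space carried by a subset of \<open>'u\<close> has an isometric copy there; the left summand ensures
  that, for every choice of \<open>'u\<close>, the space \<open>c0\<close> (of type \<open>nat \<Rightarrow> 'k\<close>) has one as well.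
\<close>

definition DPP :: "'u itself \<Rightarrow> real \<Rightarrow> ('k::scalar_field, 'v) nspace \<Rightarrow> bool" where
  "DPP (_ :: 'u itself) p X \<longleftrightarrow>
     (\<forall>Y :: ('k, (nat \<Rightarrow> 'k) + 'u) nspace. banach_space Y \<longrightarrow>
        (\<forall>T. weakly_compact_operator X Y T \<longrightarrow> unconditionally_p_converging p X Y T))"

end

theory Submission
  imports Defs
begin

text \<open>
  Four of the five properties form a cycle: \<open>DPP\<close>; the property that weakly compact operators into
  \<open>c0\<close> are unconditionally p-converging; the property of weakly null functionals on weakly p-summable
  sequences; and that of weakly Cauchy functionals on such sequences. The property of
  weakly p-Cauchy sequences is tied to that of weakly null functionals on the side.

  From \<open>DPP\<close> to \<open>c0\<close>: the space \<open>c0\<close> is a Banach space, and \<open>DPP\<close> sees it through an isometric copy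
  inside the type over which \<open>DPP\<close> quantifies (\<open>isometric_copy\<close>, \<open>DPP_imp_converging_c0\<close>).

  From \<open>c0\<close> to weakly null functionals: a weakly null sequence \<open>x'\<close> of functionals defines the
  operator that sends \<open>x\<close> to the null sequence of all \<open>x' n x\<close>. The point is that it is weakly
  compact (\<open>weakly_compact_into_c0\<close>): its image of the unit ball lies in the set of all sequences
  \<open>\<phi> (x' n)\<close> with \<open>\<phi>\<close> in the unit ball of the bidual. These are null sequences because \<open>x'\<close> is weakly
  null, and they form a weakly compact set because the bidual ball is weak* compact and
  functionals on \<open>c0\<close> have absolutely summable coefficients. The operator is thus
  unconditionally p-converging, and the norms of its values at \<open>x n\<close> dominate \<open>x' n (x n)\<close>.

  From weakly null functionals to weakly Cauchy functionals and to weakly p-Cauchy sequences one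
  uses a gliding hump: if the pairing stays away from 0, consecutive members of a sparse
  subsequence can be subtracted so that the pairing still stays away from 0, while the
  differences are weakly null or weakly p-summable, respectively. Back from weakly p-Cauchy
  sequences it suffices that weakly p-summable sequences are weakly p-Cauchy.

  From weakly Cauchy functionals to \<open>DPP\<close>: let \<open>T\<close> be weakly compact but not unconditionally
  p-converging. Cutting a bad weakly p-summable sequence into blocks, and using that \<open>l_q\<close> is dual to
  \<open>l_p\<close> inside each block, gives a weakly p-summable sequence \<open>z\<close> and functionals \<open>f i\<close> in the dual
  ball of the codomain such that \<open>f i (T (z i))\<close> stays away from 0 (\<open>not_converging_imp_blocks\<close>).
  This is a contradiction as soon as the functionals \<open>f i \<circ> T\<close> have a weakly Cauchy subsequence
  (\<open>weakly_compact_adjoint\<close>). Existence of that subsequence is a consequence of the theorems of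
  Gantmacher and Eberlein-Smulian, but here is a direct argument. By a diagonal argument pass to a
  subsequence that converges on all \<open>T d\<close>, with \<open>d\<close> in a countable part \<open>D\<close> of the unit ball on which
  finitely many of the functionals take nearly all values that they take jointly on the ball. By
  Helly's lemma each \<open>\<phi>\<close> in the bidual ball is on all \<open>f i \<circ> T\<close> the limit along a sequence in \<open>D\<close>; since
  \<open>T\<close> is weakly compact, this gives \<open>\<phi> (f i \<circ> T) = f i y\<close> for a weak cluster point \<open>y\<close> of images of
  elements of \<open>D\<close>. Any two weak* cluster points of subsequences of the chosen subsequence of \<open>f\<close> agree on
  the images of \<open>D\<close>, hence at \<open>y\<close>, so the numbers \<open>f i y\<close> converge along the chosen subsequence.
\<close>

section \<open>The scalar field\<close>

lemma scalar_embedding: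
  obtains \<phi> :: "'k::scalar_field \<Rightarrow> complex"
  where "\<And>x y. \<phi> (x + y) = \<phi> x + \<phi> y" "\<And>x y. \<phi> (x - y) = \<phi> x - \<phi> y"
    "\<And>x y. \<phi> (x * y) = \<phi> x * \<phi> y" "\<And>r. \<phi> (of_real r) = of_real r"
    "\<And>x. norm (\<phi> x) = norm x" "\<And>x y. dist (\<phi> x) (\<phi> y) = dist x y"
    "range \<phi> = \<real> \<or> range \<phi> = UNIV"
proof -
  obtain \<phi> :: "'k \<Rightarrow> complex" where
    add: "\<And>x y. \<phi> (x + y) = \<phi> x + \<phi> y" and mult: "\<And>x y. \<phi> (x * y) = \<phi> x * \<phi> y"
    and re: "\<And>r. \<phi> (scaleR r 1) = of_real r" and nrm: "\<And>x. norm (\<phi> x) = norm x"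
    and ran: "range \<phi> = \<real> \<or> range \<phi> = UNIV"
    using real_or_complex[where 'a = 'k] by blast
  have diff: "\<phi> (x - y) = \<phi> x - \<phi> y" for x y
    using add[of "x - y" y] by simp
  show thesis
    using that[of \<phi>] add mult re nrm ran diff by (simp add: of_real_def dist_norm) (metis)
qed

instance scalar_field \<subseteq> heine_borel
proof
  fix f :: "nat \<Rightarrow> 'a"
  assume bdd: "bounded (range f)"
  obtain \<phi> :: "'a \<Rightarrow> complex" where nrm: "\<And>x. norm (\<phi> x) = norm x"
    and dist: "\<And>x y. dist (\<phi> x) (\<phi> y) = dist x y" and ran: "range \<phi> = \<real> \<or> range \<phi> = UNIV"
    by (rule scalar_embedding) blast
  have "bounded (range (\<phi> \<circ> f))"
    using bdd nrm by (auto simp: bounded_iff)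
  then obtain l r where r: "strict_mono r" and l: "((\<phi> \<circ> f) \<circ> r) \<longlonglongrightarrow> l"
    using bounded_imp_convergent_subsequence by blast
  have "closed (range \<phi>)"
    using ran by (auto simp: closed_complex_Reals)
  then have "l \<in> range \<phi>"
    using closed_sequentially[OF _ _ l] by auto
  then obtain m where "l = \<phi> m" by blast
  with l dist have "(f \<circ> r) \<longlonglongrightarrow> m"
    by (simp add: tendsto_iff o_def)
  with r show "\<exists>l r. strict_mono (r::nat\<Rightarrow>nat) \<and> ((f \<circ> r) \<longlongrightarrow> l) sequentially"
    by blast
qed

instance scalar_field \<subseteq> banach
  by standard

text \<open>
  The real part and the conjugation, so that orthogonality arguments cover both scalar fields.
\<close>

lemma scalar_inner_product:
  obtains re :: "'k::scalar_field \<Rightarrow> real" and cj :: "'k \<Rightarrow> 'k"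
  where "\<And>x y. re (x + y) = re x + re y" "\<And>r x. re (of_real r * x) = r * re x"
    "\<And>r. re (of_real r) = r" "\<And>x. \<bar>re x\<bar> \<le> norm x"
    "\<And>x y. (norm (x + y))\<^sup>2 = (norm x)\<^sup>2 + 2 * re (cj x * y) + (norm y)\<^sup>2"
    "\<And>x. re (cj x * x) = (norm x)\<^sup>2"
proof -
  obtain \<phi> :: "'k \<Rightarrow> complex" where add: "\<And>x y. \<phi> (x + y) = \<phi> x + \<phi> y"
    and mult: "\<And>x y. \<phi> (x * y) = \<phi> x * \<phi> y" and of_re: "\<And>r. \<phi> (of_real r) = of_real r"
    and nrm: "\<And>x. norm (\<phi> x) = norm x" and ran: "range \<phi> = \<real> \<or> range \<phi> = UNIV"
    by (rule scalar_embedding) blast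
  \<comment> \<open>Both possible ranges of \<open>\<phi>\<close> are closed under conjugation, so it can be pulled back.\<close>
  define cj where "cj x = inv_into UNIV \<phi> (cnj (\<phi> x))" for x
  have "cnj (\<phi> x) \<in> range \<phi>" for x
    using ran by (metis Reals_cnj_iff UNIV_I complex_cnj_cnj rangeI)
  then have cj: "\<phi> (cj x) = cnj (\<phi> x)" for x
    unfolding cj_def by (rule f_inv_into_f)
  have sq: "Re (cnj z * w) * 2 = (norm (z + w))\<^sup>2 - (norm z)\<^sup>2 - (norm w)\<^sup>2" for z w
    by (simp add: cmod_power2) (simp add: power2_eq_square algebra_simps)
  show thesis
  proof (rule that[of "\<lambda>x. Re (\<phi> x)" cj])
    show "\<bar>Re (\<phi> x)\<bar> \<le> norm x" for x
      using abs_Re_le_cmod[of "\<phi> x"] nrm by simp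
    show "(norm (x + y))\<^sup>2 = (norm x)\<^sup>2 + 2 * Re (\<phi> (cj x * y)) + (norm y)\<^sup>2" for x y
      using sq[of "\<phi> x" "\<phi> y"] nrm[symmetric] by (simp add: add mult cj)
    show "Re (\<phi> (cj x * x)) = (norm x)\<^sup>2" for x
      using sq[of "\<phi> x" "\<phi> x"] nrm[symmetric, of x]
      by (simp add: mult cj cmod_power2 power2_eq_square)
  qed (simp_all add: add mult of_re)
qed

lemma scalar_separable:
  obtains Q :: "'k::scalar_field set"
  where "countable Q" "Q \<noteq> {}" "\<And>x e. e > 0 \<Longrightarrow> \<exists>q\<in>Q. dist x q < e"
proof -
  obtain \<phi> :: "'k \<Rightarrow> complex" where dist: "\<And>x y. dist (\<phi> x) (\<phi> y) = dist x y"
    by (rule scalar_embedding) blast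
  obtain T where T: "countable T" "T \<subseteq> range \<phi>" "range \<phi> \<subseteq> closure T"
    using separable by blast
  have inj: "inj \<phi>"
    by (rule injI) (metis dist dist_eq_0_iff)
  show thesis
  proof (rule that)
    show "countable (\<phi> -` T)"
      using T(1,2) inj by (intro countable_image_inj_on[of \<phi>]) (auto simp: inj_on_def)
    show ex: "\<exists>q\<in>\<phi> -` T. dist x q < e" if e: "e > 0" for x e
    proof -
      have "\<phi> x \<in> closure T" using T(3) by auto
      then obtain t where t: "t \<in> T" "dist t (\<phi> x) < e"
        using e by (metis closure_approachable)
      then obtain q where "t = \<phi> q" using T(2) by blast
      with t show ?thesis
        by (intro bexI[of _ q]) (auto simp: dist dist_commute)
    qed
    show "\<phi> -` T \<noteq> {}" using ex[of 1 0] by auto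
  qed
qed

section \<open>Normed spaces and bounded operators\<close>

lemma scalar_ring_simps [simp]:
  "carrier scalar_ring = UNIV" "mult scalar_ring = (*)" "one scalar_ring = 1"
  "zero scalar_ring = 0" "add scalar_ring = (+)"
  by (simp_all add: scalar_ring_def)

lemma cring_scalar_ring: "cring (scalar_ring :: 'k::field ring)"
proof (rule cringI)
  show "abelian_group (scalar_ring :: 'k ring)"
    by (rule abelian_groupI) (auto simp: add.assoc add.commute intro: exI[of _ "- _"])
  show "comm_monoid (scalar_ring :: 'k ring)"
    by (rule comm_monoidI) (auto simp: mult.assoc mult.commute)
qed (simp add: distrib_right)

text \<open>
  Additive inverses come from the norm: its homogeneity and definiteness force \<open>0 \<odot> x = \<zero>\<close>, so that
  \<open>(-1) \<odot> x\<close> is an inverse of \<open>x\<close>.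
\<close>

lemma normed_spaceI:
  fixes X :: "('k::scalar_field, 'v) nspace" (structure)
  assumes add: "\<And>x y. x \<in> carrier X \<Longrightarrow> y \<in> carrier X \<Longrightarrow> x \<oplus> y \<in> carrier X"
    and zero: "\<zero> \<in> carrier X"
    and smult: "\<And>a x. x \<in> carrier X \<Longrightarrow> a \<odot> x \<in> carrier X"
    and assoc: "\<And>x y z. x \<in> carrier X \<Longrightarrow> y \<in> carrier X \<Longrightarrow> z \<in> carrier X \<Longrightarrow>
      (x \<oplus> y) \<oplus> z = x \<oplus> (y \<oplus> z)"
    and comm: "\<And>x y. x \<in> carrier X \<Longrightarrow> y \<in> carrier X \<Longrightarrow> x \<oplus> y = y \<oplus> x"
    and l_zero: "\<And>x. x \<in> carrier X \<Longrightarrow> \<zero> \<oplus> x = x"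
    and l_distr: "\<And>a b x. x \<in> carrier X \<Longrightarrow> (a + b) \<odot> x = a \<odot> x \<oplus> b \<odot> x"
    and r_distr: "\<And>a x y. x \<in> carrier X \<Longrightarrow> y \<in> carrier X \<Longrightarrow> a \<odot> (x \<oplus> y) = a \<odot> x \<oplus> a \<odot> y"
    and smult_assoc: "\<And>a b x. x \<in> carrier X \<Longrightarrow> (a * b) \<odot> x = a \<odot> (b \<odot> x)"
    and one: "\<And>x. x \<in> carrier X \<Longrightarrow> 1 \<odot> x = x"
    and nonneg: "\<And>x. x \<in> carrier X \<Longrightarrow> 0 \<le> nrm X x"
    and eq0: "\<And>x. x \<in> carrier X \<Longrightarrow> nrm X x = 0 \<Longrightarrow> x = \<zero>"
    and hom: "\<And>a x. x \<in> carrier X \<Longrightarrow> nrm X (a \<odot> x) = norm a * nrm X x"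
    and tri: "\<And>x y. x \<in> carrier X \<Longrightarrow> y \<in> carrier X \<Longrightarrow> nrm X (x \<oplus> y) \<le> nrm X x + nrm X y"
  shows "normed_space X"
proof -
  have z: "0 \<odot> x = \<zero>" if "x \<in> carrier X" for x
    using that eq0[of "0 \<odot> x"] hom[of x 0] smult by simp
  have "nrm X \<zero> = 0"
    using hom[OF zero, of 0] z[OF zero] by simp
  moreover have "abelian_group X"
  proof (rule abelian_groupI)
    fix x assume x: "x \<in> carrier X"
    have "(-1) \<odot> x \<oplus> x = (-1 + 1) \<odot> x"
      by (simp only: l_distr[OF x] one[OF x])
    then show "\<exists>y\<in>carrier X. y \<oplus> x = \<zero>"
      using x z smult by auto
  qed (fact add zero assoc comm l_zero)+
  then have "Module.module (scalar_ring :: 'k ring) X"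
    by (rule moduleI[OF cring_scalar_ring]) (simp_all add: smult l_distr r_distr smult_assoc one)
  ultimately show ?thesis
    by (intro normed_space.intro normed_space_axioms.intro) (auto intro: nonneg eq0 hom tri)
qed

context normed_space
begin

lemma smult_closed' [simp, intro]: "x \<in> carrier X \<Longrightarrow> a \<odot> x \<in> carrier X"
  using smult_closed[of a x] by simp

lemma smult_zero [simp]: "x \<in> carrier X \<Longrightarrow> 0 \<odot> x = \<zero>\<^bsub>X\<^esub>"
  using smult_l_null[of x] by simp

lemma smult_add: "x \<in> carrier X \<Longrightarrow> y \<in> carrier X \<Longrightarrow> a \<odot> (x \<oplus> y) = a \<odot> x \<oplus> a \<odot> y"
  using smult_r_distr[of a x y] by simp

lemma add_smult: "x \<in> carrier X \<Longrightarrow> (a + b) \<odot> x = a \<odot> x \<oplus> b \<odot> x"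
  using smult_l_distr[of a b x] by simp

lemma mult_smult: "x \<in> carrier X \<Longrightarrow> (a * b) \<odot> x = a \<odot> (b \<odot> x)"
  using smult_assoc1[of a b x] by simp

lemma one_smult [simp]: "x \<in> carrier X \<Longrightarrow> 1 \<odot> x = x"
  using smult_one[of x] by simp

lemma minus_eq_smult: "x \<in> carrier X \<Longrightarrow> y \<in> carrier X \<Longrightarrow> x \<ominus> y = x \<oplus> (-1) \<odot> y"
proof -
  assume x: "x \<in> carrier X" and y: "y \<in> carrier X"
  have "(-1) \<odot> y \<oplus> y = (-1 + 1) \<odot> y"
    by (simp only: add_smult[OF y] one_smult[OF y])
  then have "\<ominus> y = (-1) \<odot> y"
    using y by (intro minus_equality) auto
  then show ?thesis by (simp add: a_minus_def)
qed

lemma nrm_zero [simp]: "nrm X \<zero>\<^bsub>X\<^esub> = 0"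
  using nrm_eq_0_iff[of "\<zero>\<^bsub>X\<^esub>"] by simp

lemma minus_eq_zero_iff: "x \<in> carrier X \<Longrightarrow> y \<in> carrier X \<Longrightarrow> x \<ominus> y = \<zero>\<^bsub>X\<^esub> \<longleftrightarrow> x = y"
proof
  assume xy: "x \<in> carrier X" "y \<in> carrier X" and "x \<ominus> y = \<zero>\<^bsub>X\<^esub>"
  then have "(x \<ominus> y) \<oplus> y = y" by simp
  with xy show "x = y" by (simp add: a_minus_def a_assoc l_neg)
qed (simp add: a_minus_def r_neg)

lemma nrm_minus_commute: "x \<in> carrier X \<Longrightarrow> y \<in> carrier X \<Longrightarrow> nrm X (x \<ominus> y) = nrm X (y \<ominus> x)"
proof -
  assume "x \<in> carrier X" and "y \<in> carrier X"
  then have "y \<ominus> x = (-1) \<odot> (x \<ominus> y)"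
    by (simp add: minus_eq_smult smult_add mult_smult[symmetric] a_comm)
  then show ?thesis
    using \<open>x \<in> carrier X\<close> \<open>y \<in> carrier X\<close> by (simp add: nrm_smult)
qed

lemma Metric: "Metric_space (carrier X) (ndist X)"
proof
  fix x y z
  show "0 \<le> ndist X x y"
    by (simp add: ndist_def nrm_nonneg)
  show "ndist X x y = ndist X y x"
    by (simp add: ndist_def nrm_minus_commute)
  show "ndist X x y = 0 \<longleftrightarrow> x = y" if "x \<in> carrier X" "y \<in> carrier X"
    using that by (simp add: ndist_def nrm_eq_0_iff minus_eq_zero_iff)
  show "ndist X x z \<le> ndist X x y + ndist X y z"
    if "x \<in> carrier X" "y \<in> carrier X" "z \<in> carrier X"
  proof -
    have "x \<ominus> z = (x \<ominus> y) \<oplus> (y \<ominus> z)"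
      using that by (simp add: a_minus_def a_assoc r_neg1 r_neg2 l_neg)
    then show ?thesis
      using that nrm_triangle[of "x \<ominus> y" "y \<ominus> z"] by (simp add: ndist_def)
  qed
qed

sublocale metric: Metric_space "carrier X" "ndist X"
  rewrites "Metric_space.mtopology (carrier X) (ndist X) = norm_topology X"
  by (rule Metric) (simp add: norm_topology_def)

lemma zero_in_unit_ball [simp]: "\<zero>\<^bsub>X\<^esub> \<in> unit_ball X"
  by (simp add: unit_ball_def)

end

lemma operatorI:
  assumes X: "normed_space X" and Y: "normed_space Y"
    and T: "\<And>x. x \<in> carrier X \<Longrightarrow> T x \<in> carrier Y"
    and add: "\<And>x y. x \<in> carrier X \<Longrightarrow> y \<in> carrier X \<Longrightarrow> T (x \<oplus>\<^bsub>X\<^esub> y) = T x \<oplus>\<^bsub>Y\<^esub> T y"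
    and hom: "\<And>a x. x \<in> carrier X \<Longrightarrow> T (a \<odot>\<^bsub>X\<^esub> x) = a \<odot>\<^bsub>Y\<^esub> T x"
    and bound: "\<And>x. x \<in> carrier X \<Longrightarrow> nrm Y (T x) \<le> M * nrm X x"
  shows "operator X Y T"
proof -
  interpret X: normed_space X by (rule X)
  interpret Y: normed_space Y by (rule Y)
  have diff: "T (x \<ominus>\<^bsub>X\<^esub> y) = T x \<ominus>\<^bsub>Y\<^esub> T y" if "x \<in> carrier X" "y \<in> carrier X" for x y
    using that by (simp add: X.minus_eq_smult Y.minus_eq_smult T add hom)
  define K where "K = max M 1"
  have K: "K > 0" "nrm Y (T x) \<le> K * nrm X x" if "x \<in> carrier X" for x
    using bound[OF that] X.nrm_nonneg[OF that] mult_right_mono[of M K "nrm X x"]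
    by (auto simp: K_def intro: order_trans)
  have "continuous_map (norm_topology X) (norm_topology Y) T"
    unfolding Y.metric.continuous_map_to_metric
  proof (intro ballI allI impI)
    fix x and e :: real
    assume "x \<in> topspace (norm_topology X)" and e: "0 < e"
    then have x: "x \<in> carrier X" by simp
    have "T y \<in> Y.metric.mball (T x) e" if y: "y \<in> X.metric.mball x (e / K)" for y
    proof -
      have yc: "y \<in> carrier X" and "nrm X (x \<ominus>\<^bsub>X\<^esub> y) < e / K"
        using y x by (auto simp: ndist_def)
      then have "K * nrm X (x \<ominus>\<^bsub>X\<^esub> y) < e"
        using K(1)[OF x] by (simp add: field_simps)
      then have "nrm Y (T x \<ominus>\<^bsub>Y\<^esub> T y) < e"
        using K(2)[of "x \<ominus>\<^bsub>X\<^esub> y"] x yc by (simp add: diff[symmetric])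
      then show ?thesis
        using x yc by (simp add: ndist_def T)
    qed
    moreover have "x \<in> X.metric.mball x (e / K)"
      using x e K(1)[OF x] by simp
    ultimately show "\<exists>U. openin (norm_topology X) U \<and> x \<in> U \<and> (\<forall>y\<in>U. T y \<in> Y.metric.mball (T x) e)"
      using X.metric.openin_mball by blast
  qed
  then show ?thesis
    using assms by (auto simp: operator_def)
qed

lemma operator_bounded:
  assumes X: "normed_space X" and Y: "normed_space Y" and T: "operator X Y T"
  obtains M where "M > 0" "\<And>x. x \<in> carrier X \<Longrightarrow> nrm Y (T x) \<le> M * nrm X x"
proof -
  interpret X: normed_space X by (rule X)
  interpret Y: normed_space Y by (rule Y)
  have Tc: "\<And>x. x \<in> carrier X \<Longrightarrow> T x \<in> carrier Y"
    and hom: "\<And>a x. x \<in> carrier X \<Longrightarrow> T (a \<odot>\<^bsub>X\<^esub> x) = a \<odot>\<^bsub>Y\<^esub> T x"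
    using T by (auto simp: operator_def)
  have T0: "T \<zero>\<^bsub>X\<^esub> = \<zero>\<^bsub>Y\<^esub>"
    using hom[of "\<zero>\<^bsub>X\<^esub>" 0] Tc[of "\<zero>\<^bsub>X\<^esub>"] by simp
  have "continuous_map (norm_topology X) (norm_topology Y) T"
    using T by (simp add: operator_def)
  then obtain U where U: "openin (norm_topology X) U" "\<zero>\<^bsub>X\<^esub> \<in> U"
    "\<And>y. y \<in> U \<Longrightarrow> T y \<in> Y.metric.mball (T \<zero>\<^bsub>X\<^esub>) 1"
    unfolding Y.metric.continuous_map_to_metric
    by (metis X.metric.topspace_mtopology X.zero_closed zero_less_one)
  then obtain r where r: "r > 0" "X.metric.mball \<zero>\<^bsub>X\<^esub> r \<subseteq> U"
    unfolding X.metric.openin_mtopology by blast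
  have small: "nrm Y (T y) < 1" if "y \<in> carrier X" "nrm X y < r" for y
  proof -
    have "\<zero>\<^bsub>X\<^esub> \<ominus>\<^bsub>X\<^esub> y = (-1) \<odot>\<^bsub>X\<^esub> y" "\<zero>\<^bsub>Y\<^esub> \<ominus>\<^bsub>Y\<^esub> T y = (-1) \<odot>\<^bsub>Y\<^esub> T y"
      using that by (simp_all add: X.minus_eq_smult Y.minus_eq_smult Tc)
    then have "y \<in> X.metric.mball \<zero>\<^bsub>X\<^esub> r"
      using that by (simp add: ndist_def X.nrm_smult)
    then have "T y \<in> Y.metric.mball (T \<zero>\<^bsub>X\<^esub>) 1"
      using r U by blast
    then show ?thesis
      using that \<open>\<zero>\<^bsub>Y\<^esub> \<ominus>\<^bsub>Y\<^esub> T y = (-1) \<odot>\<^bsub>Y\<^esub> T y\<close>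
      by (simp add: ndist_def T0 Tc Y.nrm_smult)
  qed
  show thesis
  proof (rule that[of "2 / r"])
    fix x assume x: "x \<in> carrier X"
    show "nrm Y (T x) \<le> 2 / r * nrm X x"
    proof (cases "nrm X x = 0")
      case True
      then show ?thesis
        using x T0 by (simp add: X.nrm_eq_0_iff)
    next
      case False
      define t where "t = r / (2 * nrm X x)"
      have n: "nrm X x > 0" using False X.nrm_nonneg[OF x] by simp
      then have t: "t > 0" using r by (simp add: t_def)
      have "nrm Y (T (of_real t \<odot>\<^bsub>X\<^esub> x)) < 1"
      proof (rule small)
        have "t * nrm X x < r" using n r by (simp add: t_def)
        then show "nrm X (of_real t \<odot>\<^bsub>X\<^esub> x) < r" using t x by (simp add: X.nrm_smult)
      qed (use x in simp)
      then have "t * nrm Y (T x) < 1"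
        using t x by (simp add: hom Y.nrm_smult Tc)
      then show ?thesis
        using n r by (simp add: t_def field_simps)
    qed
  qed (use r in simp)
qed

lemma operator_comp:
  "operator X Y T \<Longrightarrow> operator Y Z S \<Longrightarrow> operator X Z (\<lambda>x. S (T x))"
  unfolding operator_def using continuous_map_compose[of "norm_topology X" "norm_topology Y" T "norm_topology Z" S]
  by (auto simp: o_def Pi_iff)

lemma scalar_space_simps [simp]:
  "carrier scalar_space = UNIV" "zero scalar_space = 0" "add scalar_space = (+)"
  "smult scalar_space = (*)" "nrm scalar_space = norm"
  by (simp_all add: scalar_space_def)

lemma normed_scalar_space: "normed_space scalar_space"
  by (rule normed_spaceI) (auto simp: algebra_simps norm_mult norm_triangle_ineq)

section \<open>The dual space\<close>

lemma dual_simps: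
  "carrier (dual X) = {f \<in> extensional (carrier X). operator X scalar_space f}"
  "zero (dual X) = (\<lambda>x\<in>carrier X. 0)"
  "add (dual X) = (\<lambda>f g. \<lambda>x\<in>carrier X. f x + g x)"
  "smult (dual X) = (\<lambda>a f. \<lambda>x\<in>carrier X. a * f x)"
  "nrm (dual X) = (\<lambda>f. SUP x\<in>unit_ball X. norm (f x))"
  by (simp_all add: dual_def)

lemma dual_add_apply [simp]: "x \<in> carrier X \<Longrightarrow> (f \<oplus>\<^bsub>dual X\<^esub> g) x = f x + g x"
  and dual_smult_apply [simp]: "x \<in> carrier X \<Longrightarrow> (a \<odot>\<^bsub>dual X\<^esub> f) x = a * f x"
  and dual_zero_apply [simp]: "x \<in> carrier X \<Longrightarrow> \<zero>\<^bsub>dual X\<^esub> x = 0"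
  by (simp_all add: dual_simps)

context normed_space
begin

lemma dualI:
  assumes "\<And>x y. x \<in> carrier X \<Longrightarrow> y \<in> carrier X \<Longrightarrow> f (x \<oplus> y) = f x + f y"
    and "\<And>a x. x \<in> carrier X \<Longrightarrow> f (a \<odot> x) = a * f x"
    and "\<And>x. x \<in> carrier X \<Longrightarrow> norm (f x) \<le> M * nrm X x"
    and "f \<in> extensional (carrier X)"
  shows "f \<in> carrier (dual X)"
proof -
  have "operator X scalar_space f"
    by (rule operatorI[OF normed_space_axioms normed_scalar_space, where M = M]) (use assms in auto)
  with assms show ?thesis by (simp add: dual_simps)
qed

lemma dual_add: "f \<in> carrier (dual X) \<Longrightarrow> x \<in> carrier X \<Longrightarrow> y \<in> carrier X \<Longrightarrow> f (x \<oplus> y) = f x + f y"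
  and dual_smult: "f \<in> carrier (dual X) \<Longrightarrow> x \<in> carrier X \<Longrightarrow> f (a \<odot> x) = a * f x"
  by (auto simp: dual_simps operator_def)

lemma dual_diff: "f \<in> carrier (dual X) \<Longrightarrow> x \<in> carrier X \<Longrightarrow> y \<in> carrier X \<Longrightarrow> f (x \<ominus> y) = f x - f y"
  by (simp add: minus_eq_smult dual_add dual_smult)

lemma dual_zero: "f \<in> carrier (dual X) \<Longrightarrow> f \<zero>\<^bsub>X\<^esub> = 0"
  using dual_smult[of f "\<zero>\<^bsub>X\<^esub>" 0] by simp

lemma bdd_above_functional:
  assumes f: "f \<in> carrier (dual X)"
  shows "bdd_above ((\<lambda>x. norm (f x)) ` unit_ball X)"
proof -
  obtain M where M: "M > 0" "\<And>x. x \<in> carrier X \<Longrightarrow> norm (f x) \<le> M * nrm X x"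
    using operator_bounded[OF normed_space_axioms normed_scalar_space, of f] f
    by (auto simp: dual_simps)
  have "norm (f x) \<le> M" if "x \<in> unit_ball X" for x
  proof -
    have "norm (f x) \<le> M * nrm X x" using that M by (simp add: unit_ball_def)
    also have "\<dots> \<le> M * 1" using that M by (intro mult_left_mono) (auto simp: unit_ball_def)
    finally show ?thesis by simp
  qed
  then show ?thesis by (auto simp: bdd_above_def)
qed

lemma nrm_dual_le: "(\<And>x. x \<in> unit_ball X \<Longrightarrow> norm (f x) \<le> c) \<Longrightarrow> nrm (dual X) f \<le> c"
  unfolding dual_simps by (rule cSUP_least) (auto intro: zero_in_unit_ball)

lemma functional_le_nrm: "f \<in> carrier (dual X) \<Longrightarrow> x \<in> unit_ball X \<Longrightarrow> norm (f x) \<le> nrm (dual X) f"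
  unfolding dual_simps(5) by (rule cSUP_upper[OF _ bdd_above_functional])

lemma nrm_dual_nonneg: "f \<in> carrier (dual X) \<Longrightarrow> 0 \<le> nrm (dual X) f"
  using functional_le_nrm[of f "\<zero>\<^bsub>X\<^esub>"] norm_ge_zero order_trans zero_in_unit_ball by blast

lemma normalize:
  assumes "x \<in> carrier X" "nrm X x \<noteq> 0"
  shows "of_real (inverse (nrm X x)) \<odot> x \<in> unit_ball X"
  using assms nrm_nonneg[of x] by (simp add: unit_ball_def nrm_smult norm_inverse)

lemma functional_bound:
  assumes f: "f \<in> carrier (dual X)" and x: "x \<in> carrier X"
  shows "norm (f x) \<le> nrm (dual X) f * nrm X x"
proof (cases "nrm X x = 0")
  case True
  then show ?thesis using x f by (simp add: nrm_eq_0_iff dual_zero)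
next
  case False
  then have "nrm X x > 0" using nrm_nonneg[OF x] by simp
  moreover have "norm (f (of_real (inverse (nrm X x)) \<odot> x)) \<le> nrm (dual X) f"
    using False f x by (intro functional_le_nrm normalize)
  ultimately show ?thesis
    using f x by (simp add: dual_smult norm_mult norm_divide norm_inverse field_simps)
qed

lemma normed_space_dual: "normed_space (dual X)"
proof (rule normed_spaceI)
  fix f g h :: "'v \<Rightarrow> 'k" and a b :: 'k
  assume f: "f \<in> carrier (dual X)"
  note fe = f[unfolded dual_simps(1), simplified, THEN conjunct1]
  show s: "a \<odot>\<^bsub>dual X\<^esub> f \<in> carrier (dual X)"
  proof (rule dualI)
    fix x assume "x \<in> carrier X"
    then show "norm ((a \<odot>\<^bsub>dual X\<^esub> f) x) \<le> (norm a * nrm (dual X) f) * nrm X x"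
      using functional_bound[OF f] by (simp add: norm_mult mult.assoc mult_left_mono)
  qed (use f in \<open>auto simp: dual_add dual_smult algebra_simps, simp add: dual_simps\<close>)
  show "\<zero>\<^bsub>dual X\<^esub> \<oplus>\<^bsub>dual X\<^esub> f = f" "1 \<odot>\<^bsub>dual X\<^esub> f = f"
    using fe by (auto simp: dual_simps extensional_def)
  show "(a + b) \<odot>\<^bsub>dual X\<^esub> f = a \<odot>\<^bsub>dual X\<^esub> f \<oplus>\<^bsub>dual X\<^esub> b \<odot>\<^bsub>dual X\<^esub> f"
    "(a * b) \<odot>\<^bsub>dual X\<^esub> f = a \<odot>\<^bsub>dual X\<^esub> (b \<odot>\<^bsub>dual X\<^esub> f)"
    by (auto simp: dual_simps algebra_simps)
  show "0 \<le> nrm (dual X) f" by (rule nrm_dual_nonneg[OF f])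
  show "f = \<zero>\<^bsub>dual X\<^esub>" if "nrm (dual X) f = 0"
  proof (rule extensionalityI)
    fix x assume "x \<in> carrier X"
    then show "f x = \<zero>\<^bsub>dual X\<^esub> x"
      using functional_bound[OF f, of x] that by simp
  qed (use fe in \<open>auto simp: dual_simps\<close>)
  have le: "nrm (dual X) (c \<odot>\<^bsub>dual X\<^esub> u) \<le> norm c * nrm (dual X) u" if "u \<in> carrier (dual X)" for c u
    using functional_le_nrm[OF that]
    by (intro nrm_dual_le) (simp add: unit_ball_def norm_mult mult_left_mono)
  show "nrm (dual X) (a \<odot>\<^bsub>dual X\<^esub> f) = norm a * nrm (dual X) f"
  proof (cases "a = 0")
    case True
    then show ?thesis using le[OF f, of 0] nrm_dual_nonneg[OF s] by simp
  next
    case False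
    have "f = inverse a \<odot>\<^bsub>dual X\<^esub> (a \<odot>\<^bsub>dual X\<^esub> f)"
      using fe False by (auto simp: dual_simps extensional_def)
    then have "nrm (dual X) f \<le> norm (inverse a) * nrm (dual X) (a \<odot>\<^bsub>dual X\<^esub> f)"
      using le[OF s, of "inverse a"] by simp
    then show ?thesis
      using le[OF f, of a] False by (simp add: norm_inverse norm_divide field_simps)
  qed
  assume g: "g \<in> carrier (dual X)"
  show "f \<oplus>\<^bsub>dual X\<^esub> g \<in> carrier (dual X)"
  proof (rule dualI)
    fix x assume "x \<in> carrier X"
    then show "norm ((f \<oplus>\<^bsub>dual X\<^esub> g) x) \<le> (nrm (dual X) f + nrm (dual X) g) * nrm X x"
      using functional_bound[OF f, of x] functional_bound[OF g, of x] norm_triangle_ineq[of "f x" "g x"]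
      by (simp add: algebra_simps)
  qed (use f g in \<open>auto simp: dual_add dual_smult algebra_simps, simp add: dual_simps\<close>)
  show "f \<oplus>\<^bsub>dual X\<^esub> g = g \<oplus>\<^bsub>dual X\<^esub> f"
    by (simp add: dual_simps add.commute)
  show "a \<odot>\<^bsub>dual X\<^esub> (f \<oplus>\<^bsub>dual X\<^esub> g) = a \<odot>\<^bsub>dual X\<^esub> f \<oplus>\<^bsub>dual X\<^esub> a \<odot>\<^bsub>dual X\<^esub> g"
    by (auto simp: dual_simps algebra_simps)
  show "nrm (dual X) (f \<oplus>\<^bsub>dual X\<^esub> g) \<le> nrm (dual X) f + nrm (dual X) g"
  proof (rule nrm_dual_le)
    fix x assume "x \<in> unit_ball X"
    then show "norm ((f \<oplus>\<^bsub>dual X\<^esub> g) x) \<le> nrm (dual X) f + nrm (dual X) g"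
      using functional_le_nrm[OF f, of x] functional_le_nrm[OF g, of x] norm_triangle_ineq[of "f x" "g x"]
      by (simp add: unit_ball_def)
  qed
  show "(f \<oplus>\<^bsub>dual X\<^esub> g) \<oplus>\<^bsub>dual X\<^esub> h = f \<oplus>\<^bsub>dual X\<^esub> (g \<oplus>\<^bsub>dual X\<^esub> h)"
    by (auto simp: dual_simps algebra_simps)
next
  show "\<zero>\<^bsub>dual X\<^esub> \<in> carrier (dual X)"
    by (rule dualI[where M = 0]) (auto simp: dual_simps)
qed

lemma unit_ball_dual_iff:
  "f \<in> unit_ball (dual X) \<longleftrightarrow> f \<in> carrier (dual X) \<and> (\<forall>x\<in>carrier X. norm (f x) \<le> nrm X x)"
proof -
  have "nrm (dual X) f \<le> 1" if "\<forall>x\<in>carrier X. norm (f x) \<le> nrm X x"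
    using that by (intro nrm_dual_le) (auto simp: unit_ball_def intro: order_trans)
  moreover have "norm (f x) \<le> nrm X x"
    if "f \<in> carrier (dual X)" "nrm (dual X) f \<le> 1" "x \<in> carrier X" for x
    using functional_bound[OF that(1,3)] mult_right_mono[OF that(2) nrm_nonneg[OF that(3)]] by simp
  ultimately show ?thesis by (auto simp: unit_ball_def)
qed

lemma evaluation_in_bidual:
  assumes x: "x \<in> carrier X"
  shows "(\<lambda>f\<in>carrier (dual X). f x) \<in> carrier (dual (dual X))"
    and "x \<in> unit_ball X \<Longrightarrow> (\<lambda>f\<in>carrier (dual X). f x) \<in> unit_ball (dual (dual X))"
proof -
  interpret D: normed_space "dual X" by (rule normed_space_dual)
  show c: "(\<lambda>f\<in>carrier (dual X). f x) \<in> carrier (dual (dual X))"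
    by (rule D.dualI[where M = "nrm X x"])
      (use x functional_bound[OF _ x] in \<open>auto simp: mult.commute\<close>)
  show "(\<lambda>f\<in>carrier (dual X). f x) \<in> unit_ball (dual (dual X))" if "x \<in> unit_ball X"
    unfolding D.unit_ball_dual_iff using c functional_le_nrm[OF _ that] by auto
qed

lemma dual_finsum:
  assumes f: "f \<in> carrier (dual X)" and "finite J" and "\<And>j. j \<in> J \<Longrightarrow> z j \<in> carrier X"
  shows "f (\<Oplus>\<^bsub>X\<^esub>j\<in>J. a j \<odot> z j) = (\<Sum>j\<in>J. a j * f (z j))"
  using assms(2,3)
proof (induction J rule: finite_induct)
  case (insert j J)
  have "(\<Oplus>\<^bsub>X\<^esub>j\<in>insert j J. a j \<odot> z j) = a j \<odot> z j \<oplus> (\<Oplus>\<^bsub>X\<^esub>j\<in>J. a j \<odot> z j)"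
    using insert by (intro finsum_insert) auto
  moreover have "(\<Oplus>\<^bsub>X\<^esub>j\<in>J. a j \<odot> z j) \<in> carrier X"
    using insert by (intro finsum_closed) auto
  ultimately show ?case
    using insert f by (simp add: dual_add dual_smult)
qed (use f in \<open>simp add: dual_zero\<close>)

lemma dual_compose:
  assumes Y: "normed_space Y" and T: "operator X Y T" and f: "f \<in> carrier (dual Y)"
  shows "(\<lambda>x\<in>carrier X. f (T x)) \<in> carrier (dual X)"
proof -
  have fT: "operator X scalar_space (\<lambda>x. f (T x))"
    using f T by (auto simp: dual_simps intro: operator_comp)
  obtain M where "M > 0" "\<And>x. x \<in> carrier X \<Longrightarrow> norm (f (T x)) \<le> M * nrm X x"
    using operator_bounded[OF normed_space_axioms normed_scalar_space fT] by auto
  with fT show ?thesis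
    by (intro dualI[where M = M]) (auto simp: operator_def)
qed

end

section \<open>Helly's lemma and uniform boundedness\<close>

context normed_space
begin

text \<open>
  The vectors of values \<open>(h j x)\<close>, for \<open>x\<close> in the unit ball, form a convex balanced set; let \<open>x\<close>
  nearly minimise the Euclidean distance to the vector \<open>v\<close> of the numbers \<open>\<phi> (h j)\<close>. Near-minimality
  bounds the functional given by the inner product with \<open>v - (h j x)\<close> on the whole set by
  hardly more than its value at \<open>x\<close>. That functional is a linear combination of the \<open>h j\<close>, and the norm
  of this combination bounds its value under \<open>\<phi>\<close>; so the value at \<open>v\<close> exceeds the value at \<open>x\<close> by
  little. The difference of the two is the squared distance.
\<close>

lemma helly:
  fixes h :: "nat \<Rightarrow> 'v \<Rightarrow> 'k"
  assumes \<phi>: "\<phi> \<in> unit_ball (dual (dual X))" and h: "\<And>j. h j \<in> carrier (dual X)" and e: "0 < e"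
  shows "\<exists>x\<in>unit_ball X. \<forall>j<n. norm (h j x - \<phi> (h j)) < e"
proof -
  interpret D: normed_space "dual X" by (rule normed_space_dual)
  obtain re :: "'k \<Rightarrow> real" and cj :: "'k \<Rightarrow> 'k"
    where re_add: "\<And>x y. re (x + y) = re x + re y" and re_of_real: "\<And>r. re (of_real r) = r"
      and re_scale: "\<And>r x. re (of_real r * x) = r * re x" and re_le: "\<And>x. \<bar>re x\<bar> \<le> norm x"
      and expand: "\<And>x y. (norm (x + y))\<^sup>2 = (norm x)\<^sup>2 + 2 * re (cj x * y) + (norm y)\<^sup>2"
      and re_self: "\<And>x. re (cj x * x) = (norm x)\<^sup>2"
    by (rule scalar_inner_product) blast
  have re_diff: "re (x - y) = re x - re y" for x y
    using re_add[of "x - y" y] by simp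
  have re0: "re 0 = 0" using re_diff[of 0 0] by simp
  have re_sum: "re (\<Sum>j<m. g j) = (\<Sum>j<m. re (g j))" for g :: "nat \<Rightarrow> 'k" and m
    by (induction m) (simp_all add: re0 re_add)
  define dst where "dst x = (\<Sum>j<n. (norm (\<phi> (h j) - h j x))\<^sup>2)" for x
  define R where "R = (\<Sum>j<n. (2 * nrm (dual X) (h j))\<^sup>2)"
  have R: "R \<ge> 0" unfolding R_def by (intro sum_nonneg) simp
  \<comment> \<open>The step length towards a competitor; the error that it causes is \<open>t * (1 + R) / 2 < e\<^sup>2\<close>.\<close>
  define t where "t = min 1 (e\<^sup>2 / (1 + R))"
  have t: "0 < t" "t \<le> 1" using e R by (simp_all add: t_def)
  have "t * (1 + R) \<le> e\<^sup>2 / (1 + R) * (1 + R)"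
    using R by (intro mult_right_mono) (simp_all add: t_def)
  then have tR: "t * (1 + R) / 2 < e\<^sup>2"
  proof -
    have "e\<^sup>2 / (1 + R) * (1 + R) = e\<^sup>2" using R by simp
    with \<open>t * (1 + R) \<le> _\<close> zero_less_power[OF e, of 2] show ?thesis by linarith
  qed
  have "bdd_below (dst ` unit_ball X)"
    by (rule bdd_belowI[of _ 0]) (auto simp: dst_def intro: sum_nonneg)
  moreover have "(INF x\<in>unit_ball X. dst x) < (INF x\<in>unit_ball X. dst x) + t\<^sup>2"
    using t by simp
  ultimately obtain x where x: "x \<in> unit_ball X" and
    xmin: "dst x < (INF x\<in>unit_ball X. dst x) + t\<^sup>2"
    using zero_in_unit_ball cINF_less_iff[of "unit_ball X" dst] by blast
  have xle: "dst x \<le> dst y + t\<^sup>2" if "y \<in> unit_ball X" for y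
    using xmin cINF_lower[OF \<open>bdd_below (dst ` unit_ball X)\<close> that] by simp
  have xc: "x \<in> carrier X" using x by (simp add: unit_ball_def)
  define a where "a j = cj (\<phi> (h j) - h j x)" for j
  define S where "S y = (\<Sum>j<n. a j * h j y)" for y
  \<comment> \<open>Variational inequality: moving from \<open>x\<close> towards \<open>y\<close> hardly decreases the distance.\<close>
  have step: "re (S y) - re (S x) \<le> t * (1 + R) / 2" if y: "y \<in> unit_ball X" for y
  proof -
    have yc: "y \<in> carrier X" using y by (simp add: unit_ball_def)
    define z where "z = of_real (1 - t) \<odot> x \<oplus> of_real t \<odot> y"
    have "nrm X z \<le> norm (of_real (1 - t) :: 'k) * nrm X x + norm (of_real t :: 'k) * nrm X y"
      unfolding z_def using xc yc
      by (intro order_trans[OF nrm_triangle]) (simp_all add: nrm_smult del: of_real_diff)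
    also have "\<dots> \<le> (1 - t) * 1 + t * 1"
      using x y t unfolding norm_of_real by (intro add_mono mult_mono) (auto simp: unit_ball_def nrm_nonneg)
    finally have zB: "z \<in> unit_ball X"
      using xc yc by (simp add: unit_ball_def z_def)
    have coord: "(norm (\<phi> (h j) - h j z))\<^sup>2 \<le> (norm (\<phi> (h j) - h j x))\<^sup>2
        - 2 * t * re (a j * (h j y - h j x)) + t\<^sup>2 * (2 * nrm (dual X) (h j))\<^sup>2" for j
    proof -
      define u where "u = h j y - h j x"
      have "\<phi> (h j) - h j z = (\<phi> (h j) - h j x) + of_real (- t) * u"
        using xc yc h by (simp add: z_def u_def dual_add dual_smult algebra_simps)
      then have "(norm (\<phi> (h j) - h j z))\<^sup>2 = (norm (\<phi> (h j) - h j x))\<^sup>2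
          + 2 * re (a j * (of_real (- t) * u)) + (norm (of_real (- t) * u))\<^sup>2"
        unfolding a_def by (simp only: expand)
      also have "a j * (of_real (- t) * u) = of_real (- t) * (a j * u)" by simp
      also have "re \<dots> = - t * re (a j * u)" by (rule re_scale)
      also have "(norm (of_real (- t) * u))\<^sup>2 = t\<^sup>2 * (norm u)\<^sup>2"
        by (simp add: norm_mult power_mult_distrib)
      finally have eq: "(norm (\<phi> (h j) - h j z))\<^sup>2 = (norm (\<phi> (h j) - h j x))\<^sup>2
          + 2 * (- t * re (a j * u)) + t\<^sup>2 * (norm u)\<^sup>2" .
      have "norm u \<le> 2 * nrm (dual X) (h j)"
        using norm_triangle_ineq4[of "h j y" "h j x"] functional_le_nrm[OF h x, of j]
          functional_le_nrm[OF h y, of j] by (simp add: u_def)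
      then have "t\<^sup>2 * (norm u)\<^sup>2 \<le> t\<^sup>2 * (2 * nrm (dual X) (h j))\<^sup>2"
        by (intro mult_left_mono power_mono) auto
      with eq show ?thesis by (simp add: u_def)
    qed
    have "dst z \<le> (\<Sum>j<n. (norm (\<phi> (h j) - h j x))\<^sup>2
        - 2 * t * re (a j * (h j y - h j x)) + t\<^sup>2 * (2 * nrm (dual X) (h j))\<^sup>2)"
      unfolding dst_def by (intro sum_mono coord)
    also have "\<dots> = dst x - 2 * t * (\<Sum>j<n. re (a j * (h j y - h j x))) + t\<^sup>2 * R"
      by (simp add: dst_def R_def sum.distrib sum_subtractf sum_distrib_left)
    also have "(\<Sum>j<n. re (a j * (h j y - h j x))) = re (S y) - re (S x)"
      by (simp add: S_def re_sum right_diff_distrib re_diff sum_subtractf)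
    finally have "2 * t * (re (S y) - re (S x)) \<le> t\<^sup>2 * R + t\<^sup>2"
      using xle[OF zB] by simp
    then have "t * (2 * (re (S y) - re (S x))) \<le> t * (t * (1 + R))"
      by (simp add: power2_eq_square algebra_simps)
    then show ?thesis using t by simp
  qed
  define c where "c = re (S x) + t * (1 + R) / 2"
  have S_smult: "S (b \<odot> y) = b * S y" if "y \<in> carrier X" for b y
    using that h by (simp add: S_def dual_smult sum_distrib_left mult_ac)
  have "S \<zero>\<^bsub>X\<^esub> = 0" using h by (simp add: S_def dual_zero)
  then have "c \<ge> 0" using step[OF zero_in_unit_ball] by (simp add: c_def re0)
  have S_le: "norm (S y) \<le> c" if y: "y \<in> unit_ball X" for y
  proof (cases "S y = 0")
    case False
    \<comment> \<open>A rotation that turns the bound on the real part into a bound on the modulus.\<close>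
    define b where "b = of_real (norm (S y)) / S y"
    have "norm b = 1" using False by (simp add: b_def norm_divide)
    moreover have yc: "y \<in> carrier X" using y by (simp add: unit_ball_def)
    ultimately have "b \<odot> y \<in> unit_ball X" using y by (simp add: unit_ball_def nrm_smult)
    moreover have "re (S (b \<odot> y)) = norm (S y)"
      using False yc by (simp add: S_smult b_def re_of_real)
    ultimately show ?thesis using step[of "b \<odot> y"] by (simp add: c_def)
  qed (use \<open>c \<ge> 0\<close> in simp)
  define H where "H = (\<Oplus>\<^bsub>dual X\<^esub>j\<in>{..<n}. a j \<odot>\<^bsub>dual X\<^esub> h j)"
  have H: "H \<in> carrier (dual X)"
    unfolding H_def using h by (intro D.finsum_closed) auto
  have "H y = S y" if "y \<in> carrier X" for y
    using D.dual_finsum[OF evaluation_in_bidual(1)[OF that], of "{..<n}" h a] h H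
    by (simp add: S_def H_def[symmetric])
  then have "nrm (dual X) H \<le> c"
    using S_le by (intro nrm_dual_le) (simp add: unit_ball_def)
  moreover have "norm (\<phi> H) \<le> nrm (dual X) H"
    using \<phi> H D.unit_ball_dual_iff by blast
  moreover have "\<phi> H = (\<Sum>j<n. a j * \<phi> (h j))"
    unfolding H_def using \<phi> h by (intro D.dual_finsum) (auto simp: unit_ball_def)
  ultimately have "re (\<Sum>j<n. a j * \<phi> (h j)) \<le> c"
    using re_le[of "\<Sum>j<n. a j * \<phi> (h j)"] by simp
  moreover have "re (\<Sum>j<n. a j * \<phi> (h j)) - re (S x) = dst x"
    by (simp add: S_def dst_def re_self[symmetric] a_def[symmetric] re_sum re_diff
        right_diff_distrib sum_subtractf)
  ultimately have small: "dst x < e\<^sup>2" using tR by (simp add: c_def)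
  have "norm (h j x - \<phi> (h j)) < e" if "j < n" for j
  proof -
    have "(norm (\<phi> (h j) - h j x))\<^sup>2 \<le> dst x"
      unfolding dst_def using that by (intro member_le_sum) auto
    then have "(norm (\<phi> (h j) - h j x))\<^sup>2 < e\<^sup>2" using small by simp
    then show ?thesis using e by (simp add: power2_less_imp_less norm_minus_commute)
  qed
  with x show ?thesis by blast
qed

lemma continuous_map_functional:
  assumes f: "f \<in> carrier (dual X)"
  shows "continuous_map (norm_topology X) euclidean f"
proof -
  interpret S: normed_space "scalar_space :: ('k, 'k) nspace" by (rule normed_scalar_space)
  have "ndist (scalar_space :: ('k, 'k) nspace) = dist"
    by (auto simp: fun_eq_iff ndist_def dist_norm S.minus_eq_smult)
  then have "norm_topology (scalar_space :: ('k, 'k) nspace) = euclidean"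
    by (simp add: norm_topology_def)
  then show ?thesis using f by (simp add: dual_simps operator_def)
qed

text \<open>
  By Baire's theorem some set on which all \<open>f n\<close> are bounded by the same \<open>m\<close> contains a ball.
\<close>

lemma uniform_boundedness:
  assumes complete: "metric.mcomplete"
    and f: "\<And>n::nat. f n \<in> carrier (dual X)"
    and pw: "\<And>x. x \<in> carrier X \<Longrightarrow> \<exists>B. \<forall>n. norm (f n x) \<le> B"
  shows "\<exists>M. \<forall>n. nrm (dual X) (f n) \<le> M"
proof -
  define E where "E m = (\<Inter>n. {x \<in> topspace (norm_topology X). f n x \<in> cball 0 (real m)})" for m :: nat
  have closed: "closedin (norm_topology X) (E m)" for m
  proof -
    have "closedin (norm_topology X) {x \<in> topspace (norm_topology X). f n x \<in> cball 0 (real m)}" for n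
      by (rule closedin_continuous_map_preimage[OF continuous_map_functional[OF f]]) simp
    then show ?thesis unfolding E_def by (intro closedin_Inter) blast+
  qed
  have "\<exists>m. x \<in> E m" if x: "x \<in> carrier X" for x
  proof -
    obtain B where "\<forall>n. norm (f n x) \<le> B" using pw[OF x] by blast
    moreover obtain m :: nat where "B \<le> real m" using real_arch_simple by blast
    ultimately show ?thesis
      using x by (auto simp: E_def intro!: exI[of _ m] intro: order_trans)
  qed
  then have "\<Union>(range E) = topspace (norm_topology X)" by (auto simp: E_def)
  then have "norm_topology X interior_of \<Union>(range E) \<noteq> {}"
    using zero_closed interior_of_topspace[of "norm_topology X"] by auto
  then obtain m where "norm_topology X interior_of E m \<noteq> {}"
    using metric.metric_Baire_category_alt[OF complete, of "range E"] closed by auto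
  then obtain x0 where "x0 \<in> norm_topology X interior_of E m" by blast
  moreover have "openin (norm_topology X) (norm_topology X interior_of E m)" by simp
  ultimately obtain r where r: "r > 0" "metric.mball x0 r \<subseteq> norm_topology X interior_of E m"
    and x0: "x0 \<in> carrier X"
    unfolding metric.openin_mtopology by blast
  have ball: "metric.mball x0 r \<subseteq> E m" using r(2) interior_of_subset by fastforce
  have small: "norm (f n z) \<le> 2 * real m" if z: "z \<in> carrier X" "nrm X z < r" for n z
  proof -
    have "(x0 \<oplus> z) \<ominus> x0 = z"
      using z x0 by (simp add: a_minus_def a_comm[of x0 z] a_assoc r_neg)
    then have "ndist X x0 (x0 \<oplus> z) = nrm X z"
      using z x0 nrm_minus_commute[of x0 "x0 \<oplus> z"] by (simp add: ndist_def)
    then have "x0 \<oplus> z \<in> E m" "x0 \<in> E m"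
      using z x0 r ball by auto
    then have "norm (f n (x0 \<oplus> z)) \<le> real m" "norm (f n x0) \<le> real m"
      by (auto simp: E_def)
    then show ?thesis
      using norm_triangle_ineq4[of "f n (x0 \<oplus> z)" "f n x0"] z x0 f by (simp add: dual_add)
  qed
  have "nrm (dual X) (f n) \<le> 4 * real m / r" for n
  proof (rule nrm_dual_le)
    fix x assume x: "x \<in> unit_ball X"
    have "norm (f n (of_real (r / 2) \<odot> x)) \<le> 2 * real m"
    proof (rule small)
      have "r * nrm X x \<le> r * 1" using x r by (intro mult_left_mono) (auto simp: unit_ball_def)
      then show "nrm X (of_real (r / 2) \<odot> x) < r"
        using x r unfolding unit_ball_def by (simp add: nrm_smult norm_divide)
    qed (use x in \<open>simp add: unit_ball_def\<close>)
    then have "r / 2 * norm (f n x) \<le> 2 * real m"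
      using x r f by (simp add: unit_ball_def dual_smult norm_mult norm_divide)
    then show "norm (f n x) \<le> 4 * real m / r" using r by (simp add: field_simps)
  qed
  then show ?thesis by blast
qed

end

section \<open>Cluster points and weak topologies\<close>

definition cluster_point :: "'a topology \<Rightarrow> (nat \<Rightarrow> 'a) \<Rightarrow> 'a \<Rightarrow> bool" where
  "cluster_point Z x c \<longleftrightarrow> c \<in> topspace Z \<and>
     (\<forall>U. openin Z U \<longrightarrow> c \<in> U \<longrightarrow> (\<exists>\<^sub>F n in sequentially. x n \<in> U))"

text \<open>
  Weakly compact sets and dual balls are compact but in general not sequentially compact, so that
  cluster points take the place of limits of subsequences.
\<close>

lemma compactin_cluster_point:
  assumes C: "compactin Z C" and x: "\<And>n. x n \<in> C"
  shows "\<exists>c\<in>C. cluster_point Z x c"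
proof (rule ccontr)
  assume neg: "\<not> ?thesis"
  have CZ: "C \<subseteq> topspace Z" using C by (rule compactin_subset_topspace)
  have "\<exists>U. openin Z U \<and> c \<in> U \<and> (\<forall>\<^sub>F n in sequentially. x n \<notin> U)" if "c \<in> C" for c
    using neg that CZ by (auto simp: cluster_point_def frequently_def)
  then obtain U where U: "\<And>c. c \<in> C \<Longrightarrow> openin Z (U c)" "\<And>c. c \<in> C \<Longrightarrow> c \<in> U c"
    "\<And>c. c \<in> C \<Longrightarrow> \<forall>\<^sub>F n in sequentially. x n \<notin> U c"
    by metis
  have "C \<subseteq> \<Union>(U ` C)" using U by blast
  then obtain \<F> where \<F>: "finite \<F>" "\<F> \<subseteq> U ` C" "C \<subseteq> \<Union>\<F>"
    using compactinD[OF C, of "U ` C"] U by blast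
  have "\<forall>\<^sub>F n in sequentially. \<forall>V\<in>\<F>. x n \<notin> V"
    using \<F> U by (intro eventually_ball_finite) auto
  then have "\<exists>n. \<forall>V\<in>\<F>. x n \<notin> V" by (auto simp: eventually_sequentially)
  then show False using x \<F> by blast
qed

lemma cluster_point_closed:
  assumes c: "cluster_point Z x c" and g: "continuous_map Z euclidean g" and S: "closed S"
    and ev: "\<forall>\<^sub>F n in sequentially. g (x n) \<in> S"
  shows "g c \<in> S"
proof (rule ccontr)
  assume "g c \<notin> S"
  moreover have "openin Z {z \<in> topspace Z. g z \<in> - S}"
    using S by (intro openin_continuous_map_preimage[OF g]) (simp add: open_Compl)
  ultimately have "\<exists>\<^sub>F n in sequentially. x n \<in> {z \<in> topspace Z. g z \<in> - S}"
    using c unfolding cluster_point_def by auto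
  with ev have "\<exists>\<^sub>F n in sequentially. False"
    by (elim frequently_rev_mp) (auto elim: eventually_mono)
  then show False by simp
qed

lemma cluster_point_limit:
  fixes g :: "'a \<Rightarrow> 'b::metric_space"
  assumes c: "cluster_point Z x c" and g: "continuous_map Z euclidean g" and L: "(\<lambda>n. g (x n)) \<longlonglongrightarrow> L"
  shows "g c = L"
proof (rule ccontr)
  assume "g c \<noteq> L"
  then have e: "0 < dist (g c) L" by simp
  have "g c \<in> cball L (dist (g c) L / 2)"
  proof (rule cluster_point_closed[OF c g])
    show "\<forall>\<^sub>F n in sequentially. g (x n) \<in> cball L (dist (g c) L / 2)"
      using tendstoD[OF L, of "dist (g c) L / 2"] e
      by (auto elim!: eventually_mono simp: dist_commute)
  qed simp
  with e show False by (simp add: dist_commute)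
qed

context normed_space
begin

lemma topspace_weak_topology [simp]: "topspace (weak_topology X) = carrier X"
proof -
  interpret D: normed_space "dual X" by (rule normed_space_dual)
  have "carrier X = {x \<in> carrier X. \<zero>\<^bsub>dual X\<^esub> x \<in> UNIV}" by simp
  then have "carrier X \<in> {{x \<in> carrier X. f x \<in> U} | f U. f \<in> carrier (dual X) \<and> open U}"
    using D.zero_closed by blast
  then show ?thesis unfolding weak_topology_def topology_generated_by_topspace by blast
qed

lemma continuous_map_weak_functional:
  assumes f: "f \<in> carrier (dual X)"
  shows "continuous_map (weak_topology X) euclidean f"
  unfolding continuous_map_def
proof (intro conjI allI impI)
  fix U :: "'k set" assume "openin euclidean U"
  then show "openin (weak_topology X) {x \<in> topspace (weak_topology X). f x \<in> U}"
    unfolding topspace_weak_topology unfolding weak_topology_def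
    using f by (intro topology_generated_by_Basis) auto
qed simp

lemma continuous_map_into_weak:
  assumes "\<And>z. z \<in> topspace Z \<Longrightarrow> g z \<in> carrier X"
    and f: "\<And>f. f \<in> carrier (dual X) \<Longrightarrow> continuous_map Z euclidean (\<lambda>z. f (g z))"
  shows "continuous_map Z (weak_topology X) g"
  unfolding weak_topology_def
proof (rule continuous_on_generated_topo)
  show "g ` topspace Z \<subseteq> \<Union>{{x \<in> carrier X. f x \<in> U} | f U. f \<in> carrier (dual X) \<and> open U}"
    using assms(1) topspace_weak_topology unfolding weak_topology_def topology_generated_by_topspace
    by blast
next
  fix W assume "W \<in> {{x \<in> carrier X. f x \<in> U} | f U. f \<in> carrier (dual X) \<and> open U}"
  then obtain h U where W: "W = {x \<in> carrier X. h x \<in> U}" and h: "h \<in> carrier (dual X)" and U: "open U"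
    by blast
  have "g -` W \<inter> topspace Z = {z \<in> topspace Z. h (g z) \<in> U}"
    using assms(1) W by auto
  then show "openin Z (g -` W \<inter> topspace Z)"
    using openin_continuous_map_preimage[OF f[OF h], of U] U by simp
qed

lemma weakly_null_iff:
  "weakly_null X x \<longleftrightarrow> range x \<subseteq> carrier X \<and> (\<forall>f\<in>carrier (dual X). (\<lambda>n. f (x n)) \<longlonglongrightarrow> 0)"
proof (intro iffI conjI ballI)
  assume x: "weakly_null X x"
  then show "range x \<subseteq> carrier X" by (simp add: weakly_null_def)
  fix f assume f: "f \<in> carrier (dual X)"
  have "limitin (weak_topology X) x \<zero>\<^bsub>X\<^esub> sequentially" using x by (simp add: weakly_null_def)
  then have "limitin euclidean (f \<circ> x) (f \<zero>\<^bsub>X\<^esub>) sequentially"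
    by (rule continuous_map_limit[OF continuous_map_weak_functional[OF f]])
  then show "(\<lambda>n. f (x n)) \<longlonglongrightarrow> 0" using f by (simp add: dual_zero o_def)
next
  assume R: "range x \<subseteq> carrier X \<and> (\<forall>f\<in>carrier (dual X). (\<lambda>n. f (x n)) \<longlonglongrightarrow> 0)"
  have "\<forall>\<^sub>F n in sequentially. x n \<in> U"
    if "generate_topology_on {{x \<in> carrier X. f x \<in> U} | f U. f \<in> carrier (dual X) \<and> open U} U"
      "\<zero>\<^bsub>X\<^esub> \<in> U" for U
    using that
  proof induction
    case (Basis S)
    then obtain h U where S: "S = {x \<in> carrier X. h x \<in> U}" and h: "h \<in> carrier (dual X)" and U: "open U"
      by blast
    have "(\<lambda>n. h (x n)) \<longlonglongrightarrow> h \<zero>\<^bsub>X\<^esub>" using R h by (simp add: dual_zero)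
    then have "\<forall>\<^sub>F n in sequentially. h (x n) \<in> U"
      using Basis.prems S U by (auto intro: topological_tendstoD)
    then show ?case using R by (auto simp: S image_subset_iff elim!: eventually_mono)
  next
    case (UN K)
    then obtain k where "k \<in> K" "\<zero>\<^bsub>X\<^esub> \<in> k" by blast
    then show ?case using UN.IH[of k] by (auto elim: eventually_mono)
  qed (auto intro: eventually_conj)
  then have "limitin (weak_topology X) x \<zero>\<^bsub>X\<^esub> sequentially"
    unfolding limitin_def topspace_weak_topology
    by (auto simp: weak_topology_def openin_topology_generated_by_iff)
  then show "weakly_null X x" using R by (simp add: weakly_null_def)
qed

text \<open>
  The hypothesis is a case of the Hahn-Banach theorem in general; in \<open>c0\<close> the coordinates witness it.
\<close>

lemma Hausdorff_weak_topology:
  assumes "\<And>x y. x \<in> carrier X \<Longrightarrow> y \<in> carrier X \<Longrightarrow> x \<noteq> y \<Longrightarrow> \<exists>f\<in>carrier (dual X). f x \<noteq> f y"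
  shows "Hausdorff_space (weak_topology X)"
  unfolding Hausdorff_space_def topspace_weak_topology
proof (intro allI impI, elim conjE)
  fix x y assume "x \<in> carrier X" "y \<in> carrier X" "x \<noteq> y"
  then obtain f where f: "f \<in> carrier (dual X)" "f x \<noteq> f y" using assms by blast
  obtain U V where UV: "open U" "open V" "f x \<in> U" "f y \<in> V" "U \<inter> V = {}"
    using hausdorff[OF f(2)] by blast
  have "openin (weak_topology X) {z \<in> topspace (weak_topology X). f z \<in> W}" if "open W" for W
    using openin_continuous_map_preimage[OF continuous_map_weak_functional[OF f(1)]] that by simp
  then show "\<exists>U V. openin (weak_topology X) U \<and> openin (weak_topology X) V \<and> x \<in> U \<and> y \<in> V \<and> disjnt U V"
    using UV \<open>x \<in> carrier X\<close> \<open>y \<in> carrier X\<close>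
    by (intro exI[of _ "{z \<in> topspace (weak_topology X). f z \<in> U}"]
        exI[of _ "{z \<in> topspace (weak_topology X). f z \<in> V}"]) (auto simp: disjnt_def)
qed

lemma relatively_weakly_compact_subset:
  assumes H: "Hausdorff_space (weak_topology X)" and K: "compactin (weak_topology X) K" and S: "S \<subseteq> K"
  shows "relatively_weakly_compact X S"
proof -
  have "weak_topology X closure_of S \<subseteq> K"
    using compactin_imp_closedin[OF H K] S by (rule closure_of_minimal[rotated])
  then have "compactin (weak_topology X) (weak_topology X closure_of S)"
    using closed_compactin[OF K] by simp
  then show ?thesis
    using S compactin_subset_topspace[OF K] by (auto simp: relatively_weakly_compact_def)
qed

abbreviation pointwise :: "('v \<Rightarrow> 'k) topology" where
  "pointwise \<equiv> product_topology (\<lambda>_. euclidean) (carrier X)"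

text \<open>
  Inside the product of the discs of radius \<open>nrm X x\<close>, compact by Tychonoff's theorem, linearity is a
  closed condition because it only involves finitely many coordinates at a time. Boundedness, hence
  continuity, is built into the discs.
\<close>

lemma banach_alaoglu: "compactin pointwise (unit_ball (dual X))"
proof -
  define K where "K = PiE (carrier X) (\<lambda>x. cball (0::'k) (nrm X x))"
  define L where "L = (\<lambda>(x, y, a). {f \<in> topspace pointwise. f (x \<oplus> a \<odot> y) - f x - a * f y \<in> {0}})"
  have coord: "continuous_map pointwise euclidean (\<lambda>f. f x)" if "x \<in> carrier X" for x
    using that by (rule continuous_map_product_projection)
  have mult: "continuous_map pointwise euclidean (\<lambda>f. a * f x)" if "x \<in> carrier X" for x and a :: 'k
    using continuous_map_compose[OF coord[OF that], of euclidean "\<lambda>z. a * z"]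
    by (simp add: o_def continuous_intros)
  have L: "closedin pointwise (L t)" if txy: "t \<in> carrier X \<times> carrier X \<times> UNIV" for t
  proof -
    obtain x y a where t: "t = (x, y, a)" "x \<in> carrier X" "y \<in> carrier X" using txy by auto
    show ?thesis
      unfolding t(1) L_def prod.case using t(2,3)
      by (intro closedin_continuous_map_preimage[where Y = euclidean] continuous_map_diff coord mult) auto
  qed
  have K: "compactin pointwise K"
    unfolding K_def compactin_PiE by auto
  have "unit_ball (dual X) = K \<inter> (\<Inter>t\<in>carrier X \<times> carrier X \<times> UNIV. L t)" (is "_ = ?R")
  proof (intro equalityI subsetI)
    fix f assume "f \<in> unit_ball (dual X)"
    then have "f \<in> carrier (dual X)" "\<forall>x\<in>carrier X. norm (f x) \<le> nrm X x"
      by (auto simp: unit_ball_dual_iff)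
    then show "f \<in> ?R"
      by (auto simp: K_def L_def dual_add dual_smult PiE_iff) (auto simp: dual_simps)
  next
    fix f assume "f \<in> ?R"
    then have "f \<in> K" and fL: "\<And>x y a. x \<in> carrier X \<Longrightarrow> y \<in> carrier X \<Longrightarrow> f \<in> L (x, y, a)"
      by blast+
    then have f: "f \<in> extensional (carrier X)" "\<And>x. x \<in> carrier X \<Longrightarrow> norm (f x) \<le> nrm X x"
      by (auto simp: K_def PiE_iff)
    have lin: "f (x \<oplus> a \<odot> y) = f x + a * f y" if "x \<in> carrier X" "y \<in> carrier X" for x y a
    proof -
      have "f (x \<oplus> a \<odot> y) - (f x + a * f y) = 0"
        using fL[OF that, of a] by (simp add: L_def diff_diff_eq)
      then show ?thesis by simp
    qed
    have "f \<zero>\<^bsub>X\<^esub> = 0" using f(2)[of "\<zero>\<^bsub>X\<^esub>"] by simp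
    then have "f \<in> carrier (dual X)"
      using lin[of _ _ 1] lin[of "\<zero>\<^bsub>X\<^esub>"] f by (intro dualI[where M = 1]) auto
    then show "f \<in> unit_ball (dual X)" using f by (simp add: unit_ball_dual_iff)
  qed
  moreover have "closedin pointwise (\<Inter>t\<in>carrier X \<times> carrier X \<times> UNIV. L t)"
    by (intro closedin_Inter) (use L in \<open>auto intro: zero_closed\<close>)
  ultimately show ?thesis
    using K by (metis closed_Int_compactin inf_commute)
qed

end

lemma operator_weakly_continuous:
  assumes X: "normed_space X" and Y: "normed_space Y" and T: "operator X Y T"
  shows "continuous_map (weak_topology X) (weak_topology Y) T"
proof (rule normed_space.continuous_map_into_weak[OF Y])
  interpret X: normed_space X by (rule X)
  show "T z \<in> carrier Y" if "z \<in> topspace (weak_topology X)" for z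
    using that T by (auto simp: operator_def)
  fix f assume "f \<in> carrier (dual Y)"
  from X.continuous_map_weak_functional[OF X.dual_compose[OF Y T this]]
  show "continuous_map (weak_topology X) euclidean (\<lambda>z. f (T z))"
    by (rule continuous_map_eq) simp
qed

section \<open>Subsequences\<close>

lemma not_tendsto_subsequence:
  fixes u :: "nat \<Rightarrow> 'a::metric_space"
  assumes "\<not> u \<longlonglongrightarrow> L"
  obtains e and r :: "nat \<Rightarrow> nat" where "e > 0" "strict_mono r" "\<And>k. e \<le> dist (u (r k)) L"
proof -
  obtain e where e: "e > 0" and "\<not> (\<forall>\<^sub>F n in sequentially. dist (u n) L < e)"
    using assms by (auto simp: tendsto_iff)
  then have "infinite {n. e \<le> dist (u n) L}"
    by (auto simp: infinite_nat_iff_unbounded_le eventually_sequentially not_less)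
  then obtain r :: "nat \<Rightarrow> nat" where "strict_mono r" "\<And>k. r k \<in> {n. e \<le> dist (u n) L}"
    using infinite_enumerate by blast
  with e show thesis using that[of e r] by auto
qed

text \<open>
  A countable product of compact metrizable spaces is compact and first countable, hence sequentially
  compact.
\<close>

lemma diagonal_subsequence:
  fixes g :: "nat \<Rightarrow> nat \<Rightarrow> 'k::heine_borel"
  assumes "\<And>i. bounded (range (\<lambda>k. g k i))"
  obtains r l where "strict_mono (r :: nat \<Rightarrow> nat)" "\<And>i. (\<lambda>k. g (r k) i) \<longlonglongrightarrow> l i"
proof -
  define K where "K = PiE UNIV (\<lambda>i. closure (range (\<lambda>k. g k i)))"
  have "compactin (product_topology (\<lambda>_. euclidean) UNIV) K"
    unfolding K_def compactin_PiE using assms by (auto simp: compact_closure)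
  then have "compact K"
    by (simp add: euclidean_product_topology)
  then have "seq_compact K" by (rule compact_imp_seq_compact)
  moreover have "g k \<in> K" for k
    using closure_subset by (fastforce simp: K_def)
  ultimately obtain l r where r: "strict_mono r" and l: "(g \<circ> r) \<longlonglongrightarrow> l"
    unfolding seq_compact_def by blast
  have "(\<lambda>k. g (r k) i) \<longlonglongrightarrow> l i" for i
    using continuous_on_tendsto_compose[OF continuous_on_product_coordinates[of i] l] by simp
  with r show thesis by (rule that)
qed

text \<open>
  The vectors of the first \<open>n\<close> values \<open>h j x\<close> live in a separable metric space, whence a countable set
  of \<open>x\<close> suffices to approximate all of them, for all \<open>n\<close> at once.
\<close>

lemma countable_approximating_subset:
  fixes h :: "nat \<Rightarrow> 'a \<Rightarrow> 'k::scalar_field"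
  assumes "B \<noteq> {}"
  shows "\<exists>d :: nat \<Rightarrow> 'a. range d \<subseteq> B \<and>
    (\<forall>x\<in>B. \<forall>n. \<forall>e>0. \<exists>i. \<forall>j<n. dist (h j x) (h j (d i)) < e)"
proof -
  obtain Q :: "'k set" where Q: "countable Q" "Q \<noteq> {}" "\<And>x e. e > 0 \<Longrightarrow> \<exists>q\<in>Q. dist x q < e"
    by (rule scalar_separable) blast
  obtain b where b: "b \<in> B" using assms by blast
  define P where "P l m y \<longleftrightarrow> y \<in> B \<and> (\<forall>j<length l. dist (h j y) (l ! j) < inverse (real (Suc m)))"
    for l :: "'k list" and m y
  \<comment> \<open>One point of \<open>B\<close> for each finite list of targets in \<open>Q\<close> and each precision that \<open>B\<close> can meet.\<close>
  define pick where "pick = (\<lambda>(l, m). if \<exists>y. P l m y then SOME y. P l m y else b)"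
  have pick: "P l m (pick (l, m))" if "P l m y" for l m y
    unfolding pick_def prod.case using that someI[of "P l m" y] by auto
  define D where "D = pick ` (lists Q \<times> UNIV)"
  have D: "countable D" "D \<noteq> {}"
    unfolding D_def using Q(1) by auto
  have DB: "D \<subseteq> B"
  proof
    fix x assume "x \<in> D"
    then obtain l m where x: "x = pick (l, m)" by (auto simp: D_def)
    show "x \<in> B"
    proof (cases "\<exists>y. P l m y")
      case True
      then have "P l m x" using pick x by blast
      then show ?thesis by (simp add: P_def)
    next
      case False
      then show ?thesis using b by (auto simp: x pick_def)
    qed
  qed
  show ?thesis
  proof (intro exI[of _ "from_nat_into D"] conjI ballI allI impI)
    show "range (from_nat_into D) \<subseteq> B"
      using from_nat_into[OF D(2)] DB by blast
    fix x n and e :: real assume x: "x \<in> B" and e: "0 < e"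
    obtain m where m: "inverse (real (Suc m)) < e / 2"
      using reals_Archimedean[of "e / 2"] e by auto
    have "\<forall>j. \<exists>q. q \<in> Q \<and> dist (h j x) q < inverse (real (Suc m))"
      using Q(3)[of "inverse (real (Suc m))"] by auto
    then obtain q where q: "\<And>j. q j \<in> Q" "\<And>j. dist (h j x) (q j) < inverse (real (Suc m))"
      using choice[of "\<lambda>j q. q \<in> Q \<and> dist (h j x) q < inverse (real (Suc m))"] by auto
    define l where "l = map q [0..<n]"
    have "P l m x" using q x by (simp add: P_def l_def)
    then have P: "P l m (pick (l, m))" by (rule pick)
    have "l \<in> lists Q" using q by (auto simp: l_def)
    then have "pick (l, m) \<in> D" by (auto simp: D_def)
    then obtain i where i: "from_nat_into D i = pick (l, m)"
      using from_nat_into_surj[OF D(1)] by blast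
    have "dist (h j x) (h j (pick (l, m))) < e" if "j < n" for j
    proof -
      have "dist (h j (pick (l, m))) (q j) < inverse (real (Suc m))"
        using P that by (auto simp: P_def l_def)
      then show ?thesis
        using q(2)[of j] m dist_triangle2[of "h j x" "h j (pick (l, m))" "q j"] by linarith
    qed
    with i show "\<exists>i. \<forall>j<n. dist (h j x) (h j (from_nat_into D i)) < e" by (intro exI[of _ i]) simp
  qed
qed

section \<open>Adjoints of weakly compact operators\<close>

text \<open>
  The adjoint of a weakly compact operator maps the dual ball to a set in which every sequence has
  a weakly Cauchy subsequence. The subsequence is fixed by convergence on the images of a countable
  set; the two compactness properties, of the image of the ball and of the dual ball, then identify
  all cluster values of \<open>\<phi> (f (r n) \<circ> T)\<close>, as in Grothendieck's double limit criterion.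
\<close>

lemma weakly_compact_adjoint:
  fixes X :: "('k::scalar_field, 'v) nspace" and Y :: "('k, 'w) nspace"
  assumes X: "normed_space X" and Y: "normed_space Y" and T: "weakly_compact_operator X Y T"
    and f: "\<And>n::nat. f n \<in> unit_ball (dual Y)"
  obtains r where "strict_mono r" "weakly_Cauchy (dual X) (\<lambda>n. \<lambda>x\<in>carrier X. f (r n) (T x))"
proof -
  interpret X: normed_space X by (rule X)
  interpret Y: normed_space Y by (rule Y)
  interpret DX: normed_space "dual X" by (rule X.normed_space_dual)
  interpret BX: normed_space "dual (dual X)" by (rule DX.normed_space_dual)
  have op: "operator X Y T" using T by (simp add: weakly_compact_operator_def)
  have Tc: "T x \<in> carrier Y" if "x \<in> carrier X" for x
    using op that by (auto simp: operator_def)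
  have fd: "f n \<in> carrier (dual Y)" and fle: "y \<in> carrier Y \<Longrightarrow> norm (f n y) \<le> nrm Y y" for n y
    using f Y.unit_ball_dual_iff by auto
  define h where "h n = (\<lambda>x\<in>carrier X. f n (T x))" for n
  have h: "h n \<in> carrier (dual X)" for n
    unfolding h_def by (rule X.dual_compose[OF Y op fd])
  have BC: "unit_ball X \<subseteq> carrier X" by (auto simp: unit_ball_def)
  have "unit_ball X \<noteq> {}" using X.zero_in_unit_ball by blast
  from countable_approximating_subset[OF this, of h]
  obtain d :: "nat \<Rightarrow> 'v" where dB: "range d \<subseteq> unit_ball X"
    and d: "\<forall>x\<in>unit_ball X. \<forall>n. \<forall>e>0. \<exists>i. \<forall>j<n. dist (h j x) (h j (d i)) < e"
    by blast
  have dc: "d i \<in> carrier X" for i using dB BC by blast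
  have "bounded (range (\<lambda>k. f k (T (d i))))" for i
    using fle[OF Tc[OF dc]] by (auto simp: bounded_iff)
  then obtain r l where r: "strict_mono r" and l: "\<And>i. (\<lambda>k. f (r k) (T (d i))) \<longlonglongrightarrow> l i"
    by (rule diagonal_subsequence[of "\<lambda>k i. f k (T (d i))"]) blast
  \<comment> \<open>The set of all \<open>d i\<close> and the subsequence \<open>r\<close> work for every \<open>\<phi>\<close> in the bidual ball.\<close>
  have conv: "convergent (\<lambda>n. \<phi> (h (r n)))" if \<phi>: "\<phi> \<in> unit_ball (dual (dual X))" for \<phi>
  proof -
    \<comment> \<open>Helly's lemma approximates \<open>\<phi>\<close> by a point of the ball, and then by some \<open>d i\<close>.\<close>
    have "\<exists>i. \<forall>j<m. dist (h j (d i)) (\<phi> (h j)) < inverse (real (Suc m))" for m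
    proof -
      have e: "0 < inverse (real (Suc m)) / 2" by simp
      obtain x where x: "x \<in> unit_ball X" "\<forall>j<m. norm (h j x - \<phi> (h j)) < inverse (real (Suc m)) / 2"
        using X.helly[where h = h, OF \<phi> h e] by blast
      obtain i where "\<forall>j<m. dist (h j x) (h j (d i)) < inverse (real (Suc m)) / 2"
        using d x(1) e by blast
      with x(2) have "\<forall>j<m. dist (h j (d i)) (\<phi> (h j)) < inverse (real (Suc m))"
        by (metis dist_norm dist_triangle_half_r)
      then show ?thesis by blast
    qed
    then obtain i where i: "\<And>m j. j < m \<Longrightarrow> dist (h j (d (i m))) (\<phi> (h j)) < inverse (real (Suc m))"
      by metis
    have lim: "(\<lambda>m. f j (T (d (i m)))) \<longlonglongrightarrow> \<phi> (h j)" for j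
    proof (rule metric_tendsto_imp_tendsto[OF LIMSEQ_inverse_real_of_nat])
      show "\<forall>\<^sub>F m in sequentially. dist (f j (T (d (i m)))) (\<phi> (h j)) \<le> dist (inverse (real (Suc m))) 0"
        using eventually_gt_at_top[of j]
      proof eventually_elim
        case (elim m)
        then show ?case using i[OF elim] dc by (simp add: h_def)
      qed
    qed
    have "compactin (weak_topology Y) (weak_topology Y closure_of (T ` unit_ball X))"
      and sub: "T ` unit_ball X \<subseteq> topspace (weak_topology Y)"
      using T by (auto simp: weakly_compact_operator_def relatively_weakly_compact_def)
    moreover have "T (d (i m)) \<in> weak_topology Y closure_of (T ` unit_ball X)" for m
      using closure_of_subset[OF sub] dB by blast
    ultimately obtain y where y: "cluster_point (weak_topology Y) (\<lambda>m. T (d (i m))) y"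
      using compactin_cluster_point[where x = "\<lambda>m. T (d (i m))"] by blast
    then have yc: "y \<in> carrier Y" by (simp add: cluster_point_def)
    \<comment> \<open>Thus the second adjoint of \<open>T\<close> sends \<open>\<phi>\<close> to the element \<open>y\<close> of \<open>Y\<close>.\<close>
    have fy: "f j y = \<phi> (h j)" for j
      by (rule cluster_point_limit[OF y Y.continuous_map_weak_functional[OF fd] lim])
    have coord: "continuous_map Y.pointwise euclidean (\<lambda>g. g z)" if "z \<in> carrier Y" for z
      using that by (rule continuous_map_product_projection)
    obtain g where g: "g \<in> unit_ball (dual Y)" "cluster_point Y.pointwise (\<lambda>n. f (r n)) g"
      using compactin_cluster_point[where x = "\<lambda>n. f (r n)", OF Y.banach_alaoglu f] by blast
    have "(\<lambda>n. f (r n) y) \<longlonglongrightarrow> g y"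
    proof (rule ccontr)
      assume "\<not> ?thesis"
      then obtain e and s :: "nat \<Rightarrow> nat" where e: "e > 0" and s: "strict_mono s" and far: "\<And>k. e \<le> dist (f (r (s k)) y) (g y)"
        by (rule not_tendsto_subsequence) blast
      obtain g' where g': "g' \<in> unit_ball (dual Y)" "cluster_point Y.pointwise (\<lambda>n. f (r (s n))) g'"
        using compactin_cluster_point[where x = "\<lambda>n. f (r (s n))", OF Y.banach_alaoglu f] by blast
      have "g' y \<in> - ball (g y) e"
        by (rule cluster_point_closed[OF g'(2) coord[OF yc]])
          (use far in \<open>auto simp: closed_Compl dist_commute not_less\<close>)
      moreover have "g (T (d k)) = g' (T (d k))" for k
      proof -
        have "g (T (d k)) = l k"
          using cluster_point_limit[OF g(2) coord[OF Tc[OF dc[of k]]], of "l k"] l[of k] by simp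
        moreover have "g' (T (d k)) = l k"
          using cluster_point_limit[OF g'(2) coord[OF Tc[OF dc[of k]]], of "l k"]
            LIMSEQ_subseq_LIMSEQ[OF l[of k] s] by (simp add: o_def)
        ultimately show ?thesis by simp
      qed
      \<comment> \<open>The weak cluster point \<open>y\<close> of the \<open>T (d (i m))\<close> inherits the equality.\<close>
      then have "(\<lambda>m. g (T (d (i m))) - g' (T (d (i m)))) \<longlonglongrightarrow> 0" by simp
      then have "g y - g' y = 0"
        using g(1) g'(1) by (intro cluster_point_limit[OF y] continuous_map_diff
            Y.continuous_map_weak_functional) (auto simp: unit_ball_def)
      ultimately show False using e by simp
    qed
    then show ?thesis by (auto simp: fy convergent_def)
  qed
  have "Cauchy (\<lambda>n. \<phi> (h (r n)))" if \<phi>: "\<phi> \<in> carrier (dual (dual X))" for \<phi>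
  proof (cases "nrm (dual (dual X)) \<phi> = 0")
    case True
    then have "\<phi> (h (r n)) = 0" for n
      using DX.functional_bound[OF \<phi> h[of "r n"]] by simp
    then show ?thesis by (simp add: Cauchy_def)
  next
    case False
    let ?c = "of_real (inverse (nrm (dual (dual X)) \<phi>)) :: 'k"
    have "convergent (\<lambda>n. ?c * \<phi> (h (r n)))"
      using conv[OF BX.normalize[OF \<phi> False]] h by simp
    then have "convergent (\<lambda>n. \<phi> (h (r n)))"
      using False by (subst (asm) convergent_mult_const_iff) auto
    then show ?thesis by (rule convergent_Cauchy)
  qed
  then have "weakly_Cauchy (dual X) (\<lambda>n. h (r n))"
    using h by (auto simp: weakly_Cauchy_def)
  with r show thesis by (intro that[of r]) (simp_all add: h_def)
qed

section \<open>Weakly p-summable sequences\<close>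

text \<open>
  Bounds on all finite partial sums express summability and a bound on \<open>lp_norm\<close> in one condition.
  Both notions of p-summability are therefore reduced to partial sums.
\<close>

lemma sums_le_iff_lp_norm_le:
  fixes a :: "nat \<Rightarrow> 'k::real_normed_vector"
  assumes p: "0 < p" and t: "0 \<le> t"
  shows "(\<forall>N. (\<Sum>n<N. norm (a n) powr p) \<le> t powr p) \<longleftrightarrow>
    summable (\<lambda>n. norm (a n) powr p) \<and> lp_norm p a \<le> t"
proof (intro iffI allI conjI)
  assume le: "\<forall>N. (\<Sum>n<N. norm (a n) powr p) \<le> t powr p"
  show s: "summable (\<lambda>n. norm (a n) powr p)"
    by (rule summableI_nonneg_bounded[where x = "t powr p"]) (use le in auto)
  have "(\<Sum>n. norm (a n) powr p) \<le> t powr p"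
    using le by (intro suminf_le_const s) auto
  then have "lp_norm p a \<le> (t powr p) powr (1 / p)"
    unfolding lp_norm_def using p by (intro powr_mono2 suminf_nonneg s) auto
  then show "lp_norm p a \<le> t" using p t by (simp add: powr_powr)
next
  fix N assume R: "summable (\<lambda>n. norm (a n) powr p) \<and> lp_norm p a \<le> t"
  then have "(\<Sum>n<N. norm (a n) powr p) \<le> (\<Sum>n. norm (a n) powr p)"
    by (intro sum_le_suminf) auto
  also have "\<dots> = lp_norm p a powr p"
    using p R by (simp add: lp_norm_def powr_powr suminf_nonneg)
  also have "\<dots> \<le> t powr p"
    using p R by (intro powr_mono2) (auto simp: lp_norm_def)
  finally show "(\<Sum>n<N. norm (a n) powr p) \<le> t powr p" .
qed

context normed_space
begin

lemma zero_in_dual_ball: "\<zero>\<^bsub>dual X\<^esub> \<in> unit_ball (dual X)"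
  by (rule normed_space.zero_in_unit_ball[OF normed_space_dual])

lemma weakly_p_summable_iff:
  assumes p: "0 < p"
  shows "weakly_p_summable p X x \<longleftrightarrow> range x \<subseteq> carrier X \<and>
    (\<exists>C. \<forall>f\<in>unit_ball (dual X). \<forall>N. (\<Sum>n<N. norm (f (x n)) powr p) \<le> C)"
proof (intro iffI conjI)
  assume L: "weakly_p_summable p X x"
  then show "range x \<subseteq> carrier X" by (simp add: weakly_p_summable_def)
  from L obtain B where s: "\<And>f. f \<in> unit_ball (dual X) \<Longrightarrow> summable (\<lambda>n. norm (f (x n)) powr p)"
    and B: "\<And>f. f \<in> unit_ball (dual X) \<Longrightarrow> lp_norm p (\<lambda>n. f (x n)) \<le> B"
    by (auto simp: weakly_p_summable_def bdd_above_def)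
  have "(\<Sum>n<N. norm (f (x n)) powr p) \<le> max B 0 powr p" if "f \<in> unit_ball (dual X)" for f N
    using sums_le_iff_lp_norm_le[OF p, of "max B 0" "\<lambda>n. f (x n)"] s[OF that] B[OF that] by auto
  then show "\<exists>C. \<forall>f\<in>unit_ball (dual X). \<forall>N. (\<Sum>n<N. norm (f (x n)) powr p) \<le> C" by blast
next
  assume R: "range x \<subseteq> carrier X \<and>
    (\<exists>C. \<forall>f\<in>unit_ball (dual X). \<forall>N. (\<Sum>n<N. norm (f (x n)) powr p) \<le> C)"
  then obtain C where C: "\<And>f N. f \<in> unit_ball (dual X) \<Longrightarrow> (\<Sum>n<N. norm (f (x n)) powr p) \<le> C"
    by blast
  have C0: "0 \<le> C" using C[OF zero_in_dual_ball, of 0] by simp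
  have "summable (\<lambda>n. norm (f (x n)) powr p) \<and> lp_norm p (\<lambda>n. f (x n)) \<le> C powr (1 / p)"
    if "f \<in> unit_ball (dual X)" for f
    using sums_le_iff_lp_norm_le[OF p, of "C powr (1 / p)" "\<lambda>n. f (x n)"] C[OF that] C0 p
    by (simp add: powr_powr)
  then show "weakly_p_summable p X x"
    using R by (auto simp: weakly_p_summable_def bdd_above_def)
qed

lemma unconditionally_p_summable_iff:
  assumes p: "0 < p"
  shows "unconditionally_p_summable p X x \<longleftrightarrow> weakly_p_summable p X x \<and>
    (\<forall>e>0. \<exists>m. \<forall>f\<in>unit_ball (dual X). \<forall>N. (\<Sum>n<N. norm (f (x (n + m))) powr p) \<le> e)"
proof (cases "weakly_p_summable p X x")
  case True
  define S where "S m = (SUP f\<in>unit_ball (dual X). lp_norm p (\<lambda>n. f (x (n + m))))" for m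
  obtain C where C: "\<And>f N. f \<in> unit_ball (dual X) \<Longrightarrow> (\<Sum>n<N. norm (f (x n)) powr p) \<le> C"
    using True by (auto simp: weakly_p_summable_iff[OF p])
  have C0: "0 \<le> C" using C[OF zero_in_dual_ball, of 0] by simp
  have shift: "(\<Sum>n<N. norm (f (x (n + (m + k)))) powr p) \<le> (\<Sum>n<N + k. norm (f (x (n + m))) powr p)"
    for f N m k
  proof -
    have "(\<Sum>n<N. norm (f (x (n + (m + k)))) powr p) = (\<Sum>n\<in>{k..<N + k}. norm (f (x (n + m))) powr p)"
      by (rule sum.reindex_bij_witness[of _ "\<lambda>n. n - k" "\<lambda>n. n + k"]) (auto simp: ac_simps)
    also have "\<dots> \<le> (\<Sum>n<N + k. norm (f (x (n + m))) powr p)"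
      by (rule sum_mono2) auto
    finally show ?thesis .
  qed
  have tail: "(\<Sum>n<N. norm (f (x (n + m))) powr p) \<le> C" if "f \<in> unit_ball (dual X)" for f N m
    using shift[of f 0 m N] C[OF that, of "N + m"] by (simp add: add.commute)
  have iff: "(\<forall>N. (\<Sum>n<N. norm (f (x (n + m))) powr p) \<le> t powr p) \<longleftrightarrow> lp_norm p (\<lambda>n. f (x (n + m))) \<le> t"
    if "0 \<le> t" "f \<in> unit_ball (dual X)" for f t m
    using sums_le_iff_lp_norm_le[OF p that(1), of "\<lambda>n. f (x (n + m))"]
      summableI_nonneg_bounded[of "\<lambda>n. norm (f (x (n + m))) powr p" C] tail[OF that(2)] by auto
  have bdd: "bdd_above ((\<lambda>f. lp_norm p (\<lambda>n. f (x (n + m)))) ` unit_ball (dual X))" for m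
    using iff[of "C powr (1 / p)" _ m] tail C0 p
    by (intro bdd_aboveI[of _ "C powr (1 / p)"]) (auto simp: powr_powr)
  have S0: "0 \<le> S m" for m
    unfolding S_def by (rule cSUP_upper2[OF bdd zero_in_dual_ball]) (simp add: lp_norm_def)
  have S_le: "S m \<le> t \<longleftrightarrow> (\<forall>f\<in>unit_ball (dual X). \<forall>N. (\<Sum>n<N. norm (f (x (n + m))) powr p) \<le> t powr p)"
    if "0 \<le> t" for m t
    unfolding S_def using zero_in_dual_ball that iff bdd
    by (subst cSUP_le_iff) auto
  have "S \<longlonglongrightarrow> 0 \<longleftrightarrow>
    (\<forall>e>0. \<exists>m. \<forall>f\<in>unit_ball (dual X). \<forall>N. (\<Sum>n<N. norm (f (x (n + m))) powr p) \<le> e)"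
  proof (intro iffI allI impI)
    fix e :: real assume "S \<longlonglongrightarrow> 0" and e: "0 < e"
    then have "\<forall>\<^sub>F m in sequentially. S m < e powr (1 / p)"
      by (intro order_tendstoD) auto
    then obtain m where "S m \<le> e powr (1 / p)"
      by (auto simp: eventually_sequentially intro: less_imp_le)
    then have "\<forall>f\<in>unit_ball (dual X). \<forall>N. (\<Sum>n<N. norm (f (x (n + m))) powr p) \<le> e"
      using e p by (simp add: S_le powr_powr)
    then show "\<exists>m. \<forall>f\<in>unit_ball (dual X). \<forall>N. (\<Sum>n<N. norm (f (x (n + m))) powr p) \<le> e" ..
  next
    assume R: "\<forall>e>0. \<exists>m. \<forall>f\<in>unit_ball (dual X). \<forall>N. (\<Sum>n<N. norm (f (x (n + m))) powr p) \<le> e"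
    show "S \<longlonglongrightarrow> 0"
    proof (rule LIMSEQ_I)
      fix t :: real assume t: "0 < t"
      then have "0 < (t / 2) powr p" by simp
      then obtain m where m: "\<forall>f\<in>unit_ball (dual X). \<forall>N. (\<Sum>n<N. norm (f (x (n + m))) powr p) \<le> (t / 2) powr p"
        using R by blast
      have "S (m + k) \<le> t / 2" for k
        using t m by (subst S_le) (auto intro: order_trans[OF shift])
      then have "norm (S n - 0) < t" if "n \<ge> m" for n
      proof -
        have "S n \<le> t / 2" using \<open>\<And>k. S (m + k) \<le> t / 2\<close>[of "n - m"] that by simp
        then show ?thesis using S0[of n] t by simp
      qed
      then show "\<exists>m. \<forall>n\<ge>m. norm (S n - 0) < t" by blast
    qed
  qed
  with True show ?thesis by (simp add: unconditionally_p_summable_def S_def[abs_def])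
qed (simp add: unconditionally_p_summable_def)

text \<open>
  The form in which p-summability passes through operators: a functional that is pulled back along
  an operator may have norm greater than 1.
\<close>

lemma weakly_p_summable_scaled:
  assumes p: "0 < p" and x: "weakly_p_summable p X x"
  shows "\<exists>C. \<forall>f\<in>carrier (dual X). \<forall>M>0. nrm (dual X) f \<le> M \<longrightarrow>
    (\<forall>N. (\<Sum>n<N. norm (f (x n)) powr p) \<le> M powr p * C)"
proof -
  interpret D: normed_space "dual X" by (rule normed_space_dual)
  obtain C where C: "\<And>f N. f \<in> unit_ball (dual X) \<Longrightarrow> (\<Sum>n<N. norm (f (x n)) powr p) \<le> C"
    and xc: "range x \<subseteq> carrier X"
    using x by (auto simp: weakly_p_summable_iff[OF p])
  have "(\<Sum>n<N. norm (f (x n)) powr p) \<le> M powr p * C"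
    if f: "f \<in> carrier (dual X)" and M: "M > 0" "nrm (dual X) f \<le> M" for f M N
  proof -
    define g where "g = of_real (inverse M) \<odot>\<^bsub>dual X\<^esub> f"
    have "g \<in> unit_ball (dual X)"
      using f M by (simp add: g_def unit_ball_def D.nrm_smult norm_inverse norm_divide field_simps)
    then have "(\<Sum>n<N. norm (g (x n)) powr p) \<le> C" by (rule C)
    moreover have "norm (g (x n)) powr p = inverse (M powr p) * norm (f (x n)) powr p" for n
      using xc M by (simp add: g_def image_subset_iff norm_mult norm_divide inverse_eq_divide powr_divide powr_mult)
    ultimately have "inverse (M powr p) * (\<Sum>n<N. norm (f (x n)) powr p) \<le> C"
      by (simp add: sum_distrib_left)
    then show ?thesis using M by (simp add: field_simps)
  qed
  then show ?thesis by blast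
qed

lemma weakly_p_summable_imp_tendsto_0:
  assumes p: "0 < p" and x: "weakly_p_summable p X x" and f: "f \<in> carrier (dual X)"
  shows "(\<lambda>n. f (x n)) \<longlonglongrightarrow> 0"
proof -
  obtain C where C: "\<forall>f\<in>carrier (dual X). \<forall>M>0. nrm (dual X) f \<le> M \<longrightarrow>
    (\<forall>N. (\<Sum>n<N. norm (f (x n)) powr p) \<le> M powr p * C)"
    using weakly_p_summable_scaled[OF p x] by blast
  define M where "M = nrm (dual X) f + 1"
  have "M > 0" "nrm (dual X) f \<le> M" using nrm_dual_nonneg[OF f] by (auto simp: M_def)
  then have "summable (\<lambda>n. norm (f (x n)) powr p)"
    using C f by (intro summableI_nonneg_bounded[where x = "M powr p * C"]) auto
  then have "(\<lambda>n. norm (f (x n)) powr p) \<longlonglongrightarrow> 0" by (rule summable_LIMSEQ_zero)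
  then have "(\<lambda>n. (norm (f (x n)) powr p) powr (1 / p)) \<longlonglongrightarrow> 0 powr (1 / p)"
    by (rule tendsto_powr') (use p in auto)
  then show ?thesis using p by (simp add: powr_powr tendsto_norm_zero_iff)
qed

lemma weakly_p_summable_subseq:
  assumes p: "0 < p" and x: "weakly_p_summable p X x" and k: "strict_mono k"
  shows "weakly_p_summable p X (\<lambda>n. x (k n))"
proof -
  obtain C where C: "\<forall>f\<in>unit_ball (dual X). \<forall>N. (\<Sum>n<N. norm (f (x n)) powr p) \<le> C"
    and xc: "range x \<subseteq> carrier X"
    using x by (auto simp: weakly_p_summable_iff[OF p])
  have "(\<Sum>n<N. norm (f (x (k n))) powr p) \<le> C" if f: "f \<in> unit_ball (dual X)" for f N
  proof -
    have "(\<Sum>n<N. norm (f (x (k n))) powr p) = (\<Sum>n\<in>k ` {..<N}. norm (f (x n)) powr p)"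
      using k by (subst sum.reindex) (auto simp: strict_mono_imp_inj_on)
    also have "\<dots> \<le> (\<Sum>n<k N. norm (f (x n)) powr p)"
      using k by (intro sum_mono2) (auto simp: strict_mono_less)
    also have "\<dots> \<le> C" using C f by blast
    finally show ?thesis .
  qed
  then show ?thesis using xc by (auto simp: weakly_p_summable_iff[OF p])
qed

lemma weakly_p_summable_diff:
  assumes p: "0 < p" and x: "weakly_p_summable p X x" and y: "weakly_p_summable p X y"
  shows "weakly_p_summable p X (\<lambda>n. x n \<ominus> y n)"
proof -
  obtain C where C: "\<forall>f\<in>unit_ball (dual X). \<forall>N. (\<Sum>n<N. norm (f (x n)) powr p) \<le> C"
    and xc: "range x \<subseteq> carrier X"
    using x by (auto simp: weakly_p_summable_iff[OF p])
  obtain D where D: "\<forall>f\<in>unit_ball (dual X). \<forall>N. (\<Sum>n<N. norm (f (y n)) powr p) \<le> D"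
    and yc: "range y \<subseteq> carrier X"
    using y by (auto simp: weakly_p_summable_iff[OF p])
  have "(\<Sum>n<N. norm (f (x n \<ominus> y n)) powr p) \<le> 2 powr p * (C + D)"
    if f: "f \<in> unit_ball (dual X)" for f N
  proof -
    have "norm (f (x n \<ominus> y n)) powr p \<le> 2 powr p * (norm (f (x n)) powr p + norm (f (y n)) powr p)" for n
    proof -
      define m where "m = max (norm (f (x n))) (norm (f (y n)))"
      have "f (x n \<ominus> y n) = f (x n) - f (y n)"
        using f xc yc by (simp add: unit_ball_def dual_diff image_subset_iff)
      then have "norm (f (x n \<ominus> y n)) \<le> 2 * m"
        using norm_triangle_ineq4[of "f (x n)" "f (y n)"] by (simp add: m_def)
      then have "norm (f (x n \<ominus> y n)) powr p \<le> (2 * m) powr p"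
        using p by (intro powr_mono2) auto
      also have "\<dots> = 2 powr p * m powr p" by (simp add: powr_mult m_def)
      also have "m powr p \<le> norm (f (x n)) powr p + norm (f (y n)) powr p"
        by (auto simp: m_def max_def)
      finally show ?thesis by simp
    qed
    then have "(\<Sum>n<N. norm (f (x n \<ominus> y n)) powr p)
        \<le> (\<Sum>n<N. 2 powr p * (norm (f (x n)) powr p + norm (f (y n)) powr p))"
      by (intro sum_mono)
    also have "\<dots> = 2 powr p * ((\<Sum>n<N. norm (f (x n)) powr p) + (\<Sum>n<N. norm (f (y n)) powr p))"
      by (simp only: sum.distrib sum_distrib_left[symmetric])
    also have "\<dots> \<le> 2 powr p * (C + D)"
      using C D f by (intro mult_left_mono add_mono) auto
    finally show ?thesis .
  qed
  then show ?thesis using xc yc by (auto simp: weakly_p_summable_iff[OF p] image_subset_iff)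
qed

end

lemma weakly_p_summable_operator:
  assumes X: "normed_space X" and Y: "normed_space Y" and p: "0 < p"
    and T: "operator X Y T" and x: "weakly_p_summable p X x"
  shows "weakly_p_summable p Y (\<lambda>n. T (x n))"
proof -
  interpret X: normed_space X by (rule X)
  interpret Y: normed_space Y by (rule Y)
  obtain M where M: "M > 0" "\<And>x. x \<in> carrier X \<Longrightarrow> nrm Y (T x) \<le> M * nrm X x"
    using operator_bounded[OF X Y T] by blast
  obtain C where C: "\<forall>f\<in>carrier (dual X). \<forall>M>0. nrm (dual X) f \<le> M \<longrightarrow>
    (\<forall>N. (\<Sum>n<N. norm (f (x n)) powr p) \<le> M powr p * C)"
    using X.weakly_p_summable_scaled[OF p x] by blast
  have xc: "\<And>n. x n \<in> carrier X" using x by (auto simp: weakly_p_summable_def)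
  have Tc: "T z \<in> carrier Y" if "z \<in> carrier X" for z using that T by (auto simp: operator_def)
  have "(\<Sum>n<N. norm (f (T (x n))) powr p) \<le> M powr p * C" if f: "f \<in> unit_ball (dual Y)" for f N
  proof -
    have fd: "f \<in> carrier (dual Y)" using f by (simp add: unit_ball_def)
    define g where "g = (\<lambda>z\<in>carrier X. f (T z))"
    have "g \<in> carrier (dual X)" unfolding g_def by (rule X.dual_compose[OF Y T fd])
    moreover have "nrm (dual X) g \<le> M"
    proof (rule X.nrm_dual_le)
      fix z assume z: "z \<in> unit_ball X"
      then have zc: "z \<in> carrier X" by (simp add: unit_ball_def)
      have "norm (f (T z)) \<le> nrm Y (T z)"
        using f Tc[OF zc] by (simp add: Y.unit_ball_dual_iff)
      also have "\<dots> \<le> M * nrm X z" by (rule M(2)[OF zc])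
      also have "\<dots> \<le> M * 1" using z M(1) by (intro mult_left_mono) (auto simp: unit_ball_def)
      finally show "norm (g z) \<le> M" using zc by (simp add: g_def)
    qed
    ultimately have "(\<Sum>n<N. norm (g (x n)) powr p) \<le> M powr p * C" using C M(1) by blast
    then show ?thesis using xc by (simp add: g_def)
  qed
  then show ?thesis using xc Tc by (auto simp: Y.weakly_p_summable_iff[OF p])
qed

lemma unconditionally_p_summable_contraction:
  assumes X: "normed_space X" and Y: "normed_space Y" and p: "0 < p"
    and T: "operator X Y T" and contr: "\<And>x. x \<in> carrier X \<Longrightarrow> nrm Y (T x) \<le> nrm X x"
    and x: "unconditionally_p_summable p X x"
  shows "unconditionally_p_summable p Y (\<lambda>n. T (x n))"
proof -
  interpret X: normed_space X by (rule X)
  interpret Y: normed_space Y by (rule Y)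
  have wx: "weakly_p_summable p X x" using x by (simp add: unconditionally_p_summable_def)
  have xc: "\<And>n. x n \<in> carrier X" using wx by (auto simp: weakly_p_summable_def)
  have Tc: "T z \<in> carrier Y" if "z \<in> carrier X" for z using that T by (auto simp: operator_def)
  have g: "(\<lambda>z\<in>carrier X. f (T z)) \<in> unit_ball (dual X)" if f: "f \<in> unit_ball (dual Y)" for f
    using f X.dual_compose[OF Y T, of f] contr Tc
    by (auto simp: X.unit_ball_dual_iff Y.unit_ball_dual_iff intro: order_trans)
  have "\<exists>m. \<forall>f\<in>unit_ball (dual Y). \<forall>N. (\<Sum>n<N. norm (f (T (x (n + m)))) powr p) \<le> e" if e: "e > 0" for e
  proof -
    obtain m where m: "\<And>f N. f \<in> unit_ball (dual X) \<Longrightarrow> (\<Sum>n<N. norm (f (x (n + m))) powr p) \<le> e"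
      using x e X.unconditionally_p_summable_iff[OF p] by blast
    have "(\<Sum>n<N. norm (f (T (x (n + m)))) powr p) \<le> e" if "f \<in> unit_ball (dual Y)" for f N
      using m[OF g[OF that], of N] xc by simp
    then show ?thesis by blast
  qed
  with weakly_p_summable_operator[OF X Y p T wx] show ?thesis
    by (simp add: Y.unconditionally_p_summable_iff[OF p])
qed

text \<open>
  Hoelder's inequality for a vector in the unit ball of \<open>l_q\<close>, where \<open>q = p / (p - 1)\<close>, from Young's
  inequality applied to \<open>c\<close> divided by its \<open>l_p\<close> norm.
\<close>

lemma hoelder_unit:
  fixes a c :: "'i \<Rightarrow> real"
  assumes p: "1 < p" and a: "\<And>i. i \<in> I \<Longrightarrow> 0 \<le> a i" and c: "\<And>i. i \<in> I \<Longrightarrow> 0 \<le> c i"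
    and le1: "(\<Sum>i\<in>I. a i powr (p / (p - 1))) \<le> 1" and I: "finite I"
  shows "(\<Sum>i\<in>I. a i * c i) powr p \<le> (\<Sum>i\<in>I. c i powr p)"
proof -
  define S where "S = (\<Sum>i\<in>I. c i powr p)"
  define C where "C = S powr (1 / p)"
  define q where "q = p / (p - 1)"
  have q: "q > 1" "1 / p + 1 / q = 1" using p by (auto simp: q_def field_simps)
  have S0: "0 \<le> S" unfolding S_def by (intro sum_nonneg) simp
  show ?thesis
  proof (cases "S = 0")
    case True
    then have "\<forall>i\<in>I. c i powr p = 0"
      unfolding S_def using I by (subst (asm) sum_nonneg_eq_0_iff) auto
    then show ?thesis by simp
  next
    case False
    then have C: "C > 0" using S0 by (simp add: C_def)
    have Cp: "C powr p = S" using S0 p by (simp add: C_def powr_powr)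
    have "(\<Sum>i\<in>I. c i / C * a i) \<le> (\<Sum>i\<in>I. (c i / C) powr p / p + a i powr q / q)"
      using p q a c C by (intro sum_mono Youngs_inequality) auto
    also have "\<dots> = (\<Sum>i\<in>I. c i powr p) / C powr p / p + (\<Sum>i\<in>I. a i powr q) / q"
      using c C by (simp add: sum.distrib sum_divide_distrib powr_divide)
    also have "\<dots> \<le> 1 / p + 1 / q"
      using le1 q p False by (intro add_mono divide_right_mono) (auto simp: Cp S_def[symmetric] q_def)
    finally have "(\<Sum>i\<in>I. a i * c i) / C \<le> 1"
      using q by (simp add: sum_divide_distrib mult.commute)
    then have "(\<Sum>i\<in>I. a i * c i) \<le> C" using C by (simp add: field_simps)
    then have "(\<Sum>i\<in>I. a i * c i) powr p \<le> C powr p"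
      using p a c by (intro powr_mono2 sum_nonneg) auto
    then show ?thesis by (simp add: Cp S_def)
  qed
qed

text \<open>
  By Hoelder's inequality, the p-th power of a functional at a block is at most the sum of its p-th
  powers over the block, and the blocks are disjoint.
\<close>

lemma (in normed_space) weakly_p_summable_blocks:
  assumes p: "1 < p" and x: "weakly_p_summable p X x" and k: "strict_mono k"
    and a: "\<And>i. (\<Sum>n\<in>{k i..<k (Suc i)}. norm (a i n) powr (p / (p - 1))) \<le> 1"
  shows "weakly_p_summable p X (\<lambda>i. \<Oplus>\<^bsub>X\<^esub>n\<in>{k i..<k (Suc i)}. a i n \<odot> x n)"
proof -
  have p0: "0 < p" using p by simp
  obtain C where C: "\<forall>f\<in>unit_ball (dual X). \<forall>N. (\<Sum>n<N. norm (f (x n)) powr p) \<le> C"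
    and xc: "\<And>n. x n \<in> carrier X"
    using x by (auto simp: weakly_p_summable_iff[OF p0])
  have "(\<Sum>i<N. norm (f (\<Oplus>\<^bsub>X\<^esub>n\<in>{k i..<k (Suc i)}. a i n \<odot> x n)) powr p) \<le> C"
    if f: "f \<in> unit_ball (dual X)" for f N
  proof -
    have fd: "f \<in> carrier (dual X)" using f by (simp add: unit_ball_def)
    have "norm (f (\<Oplus>\<^bsub>X\<^esub>n\<in>{k i..<k (Suc i)}. a i n \<odot> x n)) powr p
        \<le> (\<Sum>n\<in>{k i..<k (Suc i)}. norm (f (x n)) powr p)" for i
    proof -
      have "norm (f (\<Oplus>\<^bsub>X\<^esub>n\<in>{k i..<k (Suc i)}. a i n \<odot> x n))
          = norm (\<Sum>n\<in>{k i..<k (Suc i)}. a i n * f (x n))"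
        by (subst dual_finsum[OF fd]) (use xc in auto)
      also have "\<dots> \<le> (\<Sum>n\<in>{k i..<k (Suc i)}. norm (a i n) * norm (f (x n)))"
        by (rule order_trans[OF norm_sum]) (simp add: norm_mult)
      finally have "norm (f (\<Oplus>\<^bsub>X\<^esub>n\<in>{k i..<k (Suc i)}. a i n \<odot> x n)) powr p
          \<le> (\<Sum>n\<in>{k i..<k (Suc i)}. norm (a i n) * norm (f (x n))) powr p"
        using p by (intro powr_mono2) auto
      also have "\<dots> \<le> (\<Sum>n\<in>{k i..<k (Suc i)}. norm (f (x n)) powr p)"
        by (rule hoelder_unit[OF p]) (use a in auto)
      finally show ?thesis .
    qed
    then have "(\<Sum>i<N. norm (f (\<Oplus>\<^bsub>X\<^esub>n\<in>{k i..<k (Suc i)}. a i n \<odot> x n)) powr p)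
        \<le> (\<Sum>i<N. \<Sum>n\<in>{k i..<k (Suc i)}. norm (f (x n)) powr p)"
      by (intro sum_mono)
    also have "\<dots> = (\<Sum>n\<in>{k 0..<k N}. norm (f (x n)) powr p)"
    proof (induction N)
      case (Suc N)
      have "k 0 \<le> k N" "k N \<le> k (Suc N)" using k by (simp_all add: strict_mono_less_eq)
      then show ?case using Suc.IH by (simp add: sum.atLeastLessThan_concat)
    qed simp
    also have "\<dots> \<le> (\<Sum>n<k N. norm (f (x n)) powr p)" by (intro sum_mono2) auto
    also have "\<dots> \<le> C" using C f by blast
    finally show ?thesis .
  qed
  moreover have "(\<Oplus>\<^bsub>X\<^esub>n\<in>{k i..<k (Suc i)}. a i n \<odot> x n) \<in> carrier X" for i
    by (intro finsum_closed) (use xc in auto)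
  ultimately show ?thesis by (auto simp: weakly_p_summable_iff[OF p0])
qed

section \<open>The space of null sequences\<close>

lemma c0_simps:
  "carrier c0 = {x. x \<longlonglongrightarrow> 0}" "zero c0 = (\<lambda>n. 0)" "add c0 = (\<lambda>x y n. x n + y n)"
  "smult c0 = (\<lambda>a x n. a * x n)" "nrm c0 = (\<lambda>x. SUP n. norm (x n))"
  by (simp_all add: c0_def)

lemma coordinate_le_c0_norm:
  fixes x :: "nat \<Rightarrow> 'k::scalar_field"
  assumes "x \<longlonglongrightarrow> 0"
  shows "norm (x n) \<le> nrm c0 x"
proof -
  have "bounded (range x)" using assms by (rule convergent_imp_bounded)
  then have "bdd_above (range (\<lambda>n. norm (x n)))" by (auto simp: bounded_iff bdd_above_def)
  then show ?thesis unfolding c0_simps by (rule cSUP_upper[rotated]) simp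
qed

lemma c0_norm_le: "(\<And>n. norm (x n) \<le> B) \<Longrightarrow> nrm c0 x \<le> B"
  unfolding c0_simps by (rule cSUP_least) auto

lemma normed_space_c0: "normed_space (c0 :: ('k::scalar_field, nat \<Rightarrow> 'k) nspace)"
proof (rule normed_spaceI)
  fix x y :: "nat \<Rightarrow> 'k" and a :: 'k
  assume x: "x \<in> carrier c0"
  then have xl: "x \<longlonglongrightarrow> 0" by (simp add: c0_simps)
  have ax: "(\<lambda>n. b * x n) \<longlonglongrightarrow> 0" for b
    using tendsto_mult_left[OF xl, of b] by simp
  then show "a \<odot>\<^bsub>c0\<^esub> x \<in> carrier c0" by (simp add: c0_simps)
  show "0 \<le> nrm c0 x"
    using coordinate_le_c0_norm[OF xl, of 0] norm_ge_zero order_trans by blast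
  show "x = \<zero>\<^bsub>c0\<^esub>" if "nrm c0 x = 0"
    using coordinate_le_c0_norm[OF xl] that by (auto simp: c0_simps(2))
  have le: "nrm c0 (\<lambda>n. b * z n) \<le> norm b * nrm c0 z" if "z \<longlonglongrightarrow> 0" for b z
    using coordinate_le_c0_norm[OF that] by (intro c0_norm_le) (simp add: norm_mult mult_left_mono)
  show "nrm c0 (a \<odot>\<^bsub>c0\<^esub> x) = norm a * nrm c0 x"
  proof (cases "a = 0")
    case True
    then show ?thesis by (simp add: c0_simps)
  next
    case False
    have "nrm c0 x \<le> norm (inverse a) * nrm c0 (\<lambda>n. a * x n)"
      using le[OF ax[of a], of "inverse a"] False by (simp flip: mult.assoc)
    then have "norm a * nrm c0 x \<le> nrm c0 (\<lambda>n. a * x n)"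
      using False by (simp add: norm_inverse norm_divide field_simps)
    then show ?thesis using le[OF xl, of a] by (simp add: c0_simps(4))
  qed
  assume y: "y \<in> carrier c0"
  then have yl: "y \<longlonglongrightarrow> 0" by (simp add: c0_simps)
  show "x \<oplus>\<^bsub>c0\<^esub> y \<in> carrier c0"
    using tendsto_add[OF xl yl] by (simp add: c0_simps)
  show "nrm c0 (x \<oplus>\<^bsub>c0\<^esub> y) \<le> nrm c0 x + nrm c0 y"
    unfolding c0_simps(3)
    by (intro c0_norm_le order_trans[OF norm_triangle_ineq] add_mono coordinate_le_c0_norm xl yl)
qed (auto simp: c0_simps algebra_simps)

lemma minus_c0:
  fixes x y :: "nat \<Rightarrow> 'k::scalar_field"
  assumes "x \<in> carrier c0" "y \<in> carrier c0"
  shows "x \<ominus>\<^bsub>c0\<^esub> y = (\<lambda>n. x n - y n)"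
  using normed_space.minus_eq_smult[OF normed_space_c0 assms] by (simp add: c0_simps)

lemma banach_space_c0: "banach_space (c0 :: ('k::scalar_field, nat \<Rightarrow> 'k) nspace)"
proof -
  interpret C: normed_space "c0 :: ('k, nat \<Rightarrow> 'k) nspace" by (rule normed_space_c0)
  have "\<exists>y. limitin (norm_topology c0) s y sequentially" if s: "C.metric.MCauchy s" for s :: "nat \<Rightarrow> nat \<Rightarrow> 'k"
  proof -
    have sc: "s n \<longlonglongrightarrow> 0" for n
    proof -
      have "s n \<in> carrier c0" using s unfolding C.metric.MCauchy_def by blast
      then show ?thesis by (simp add: c0_simps)
    qed
    have dist: "ndist c0 x y = nrm c0 (\<lambda>n. x n - y n)" if "x \<longlonglongrightarrow> 0" "y \<longlonglongrightarrow> 0" for x y :: "nat \<Rightarrow> 'k"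
      using that by (simp add: ndist_def minus_c0) (simp add: c0_simps)
    have cauchy: "\<exists>N. \<forall>m\<ge>N. \<forall>n\<ge>N. \<forall>i. norm (s m i - s n i) < e" if e: "e > 0" for e
    proof -
      obtain N where "\<And>m n. m \<ge> N \<Longrightarrow> n \<ge> N \<Longrightarrow> ndist c0 (s m) (s n) < e"
        using s e unfolding C.metric.MCauchy_def by blast
      moreover have "norm (s m i - s n i) \<le> ndist c0 (s m) (s n)" for m n i
        using coordinate_le_c0_norm[OF tendsto_diff[OF sc sc, unfolded diff_0_right], where n = i] sc
        by (simp add: dist)
      ultimately show ?thesis by (meson le_less_trans)
    qed
    have "convergent (\<lambda>n. s n i)" for i
      unfolding Cauchy_convergent_iff[symmetric] Cauchy_iff using cauchy by blast
    then obtain y where y: "\<And>i. (\<lambda>n. s n i) \<longlonglongrightarrow> y i"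
      unfolding convergent_def by metis
    have unif: "\<exists>N. \<forall>m\<ge>N. \<forall>i. norm (s m i - y i) \<le> e" if e: "e > 0" for e
    proof -
      obtain N where N: "\<And>m n i. m \<ge> N \<Longrightarrow> n \<ge> N \<Longrightarrow> norm (s m i - s n i) < e"
        using cauchy[OF e] by blast
      have "norm (s m i - y i) \<le> e" if "m \<ge> N" for m i
      proof (rule LIMSEQ_le_const2)
        show "(\<lambda>n. norm (s m i - s n i)) \<longlonglongrightarrow> norm (s m i - y i)"
          by (intro tendsto_intros y)
        show "\<exists>N. \<forall>n\<ge>N. norm (s m i - s n i) \<le> e"
          using N that by (meson less_imp_le)
      qed
      then show ?thesis by blast
    qed
    have y0: "y \<longlonglongrightarrow> 0"
    proof (rule LIMSEQ_I)
      fix e :: real assume e: "0 < e"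
      obtain N where N: "\<And>i. norm (s N i - y i) \<le> e / 2" using unif[of "e / 2"] e by auto
      obtain M where M: "\<And>i. i \<ge> M \<Longrightarrow> norm (s N i) < e / 2"
        using LIMSEQ_D[OF sc[of N], of "e / 2"] e by auto
      have "norm (y i - 0) < e" if "i \<ge> M" for i
        using N[of i] M[OF that] norm_triangle_ineq4[of "s N i" "s N i - y i"] by simp
      then show "\<exists>M. \<forall>i\<ge>M. norm (y i - 0) < e" by blast
    qed
    have "limitin (norm_topology c0) s y sequentially"
      unfolding C.metric.limitin_metric
    proof (intro conjI allI impI)
      show "y \<in> carrier c0" using y0 by (simp add: c0_simps)
      fix e :: real assume "0 < e"
      then obtain N where N: "\<And>m i. m \<ge> N \<Longrightarrow> norm (s m i - y i) \<le> e / 2"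
        using unif[of "e / 2"] by auto
      have "ndist c0 (s m) y \<le> e / 2" if "m \<ge> N" for m
        unfolding dist[OF sc y0] by (rule c0_norm_le[OF N[OF that]])
      then show "\<forall>\<^sub>F m in sequentially. s m \<in> carrier c0 \<and> ndist c0 (s m) y < e"
        using sc \<open>0 < e\<close> by (intro eventually_sequentiallyI[of N]) (force simp: c0_simps(1))
    qed
    then show ?thesis by blast
  qed
  then have "C.metric.mcomplete" unfolding C.metric.mcomplete_def by blast
  then show ?thesis by (intro banach_space.intro banach_space_axioms.intro normed_space_c0)
qed

lemma c0_coordinate_functional:
  "(\<lambda>x\<in>carrier c0. x n) \<in> unit_ball (dual (c0 :: ('k::scalar_field, nat \<Rightarrow> 'k) nspace))"
proof -
  interpret C: normed_space "c0 :: ('k, nat \<Rightarrow> 'k) nspace" by (rule normed_space_c0)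
  have le: "norm (x n) \<le> nrm c0 x" if "x \<in> carrier c0" for x :: "nat \<Rightarrow> 'k"
    using that coordinate_le_c0_norm by (auto simp: c0_simps(1))
  have "(\<lambda>x\<in>carrier c0. x n) \<in> carrier (dual (c0 :: ('k, nat \<Rightarrow> 'k) nspace))"
  proof (rule C.dualI[where M = 1])
    fix x y :: "nat \<Rightarrow> 'k" and a :: 'k
    assume x: "x \<in> carrier c0"
    show "(\<lambda>x\<in>carrier c0. x n) (a \<odot>\<^bsub>c0\<^esub> x) = a * (\<lambda>x\<in>carrier c0. x n) x"
      using x C.smult_closed'[OF x, of a] by (simp add: c0_simps(4))
    show "(\<lambda>x\<in>carrier c0. x n) (x \<oplus>\<^bsub>c0\<^esub> y) = (\<lambda>x\<in>carrier c0. x n) x + (\<lambda>x\<in>carrier c0. x n) y"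
      if "y \<in> carrier c0"
      using x that C.add.m_closed[OF x that] by (simp add: c0_simps(3))
  qed (use le in auto)
  then show ?thesis using le by (simp add: C.unit_ball_dual_iff)
qed

lemma Hausdorff_weak_c0: "Hausdorff_space (weak_topology (c0 :: ('k::scalar_field, nat \<Rightarrow> 'k) nspace))"
proof -
  interpret C: normed_space "c0 :: ('k, nat \<Rightarrow> 'k) nspace" by (rule normed_space_c0)
  show ?thesis
  proof (rule C.Hausdorff_weak_topology)
    fix x y :: "nat \<Rightarrow> 'k" assume xy: "x \<in> carrier c0" "y \<in> carrier c0" "x \<noteq> y"
    then obtain n where "x n \<noteq> y n" by blast
    then show "\<exists>f\<in>carrier (dual c0). f x \<noteq> f y"
      using xy c0_coordinate_functional[of n]
      by (intro bexI[of _ "\<lambda>x\<in>carrier c0. x n"]) (auto simp: unit_ball_def)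
  qed
qed

definition unit_vector :: "nat \<Rightarrow> nat \<Rightarrow> 'k::scalar_field" where
  "unit_vector n = (\<lambda>i. if i = n then 1 else 0)"

lemma eventually_zero_in_c0:
  fixes y :: "nat \<Rightarrow> 'k::scalar_field"
  shows "(\<And>i. i \<ge> N \<Longrightarrow> y i = 0) \<Longrightarrow> y \<in> carrier c0"
  unfolding c0_simps mem_Collect_eq
  by (rule tendsto_eventually) (auto simp: eventually_sequentially)

lemma c0_functional_truncation:
  fixes f :: "(nat \<Rightarrow> 'k::scalar_field) \<Rightarrow> 'k"
  assumes f: "f \<in> carrier (dual c0)"
  shows "f (\<lambda>i. if i < N then y i else 0) = (\<Sum>n<N. f (unit_vector n) * y n)"
proof (induction N)
  interpret C: normed_space "c0 :: ('k, nat \<Rightarrow> 'k) nspace" by (rule normed_space_c0)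
  case 0
  then show ?case using C.dual_zero[OF f] by (simp add: c0_simps)
next
  interpret C: normed_space "c0 :: ('k, nat \<Rightarrow> 'k) nspace" by (rule normed_space_c0)
  case (Suc N)
  have "(\<lambda>i. if i < Suc N then y i else 0)
      = (\<lambda>i. if i < N then y i else 0) \<oplus>\<^bsub>c0\<^esub> y N \<odot>\<^bsub>c0\<^esub> unit_vector N"
    by (auto simp: c0_simps unit_vector_def fun_eq_iff less_Suc_eq)
  moreover have "(\<lambda>i. if i < N then y i else 0) \<in> carrier c0"
    by (rule eventually_zero_in_c0[of N]) simp
  moreover have "unit_vector N \<in> carrier (c0 :: ('k, nat \<Rightarrow> 'k) nspace)"
    by (rule eventually_zero_in_c0[of "Suc N"]) (simp add: unit_vector_def)
  ultimately show ?case using Suc f by (simp add: C.dual_add C.dual_smult)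
qed

text \<open>
  Test \<open>f\<close> on the finite sequences in the unit ball whose entries rotate the values at the unit
  vectors to their moduli.
\<close>

lemma c0_functional_summable:
  fixes f :: "(nat \<Rightarrow> 'k::scalar_field) \<Rightarrow> 'k"
  assumes f: "f \<in> carrier (dual c0)"
  shows "summable (\<lambda>n. norm (f (unit_vector n)))"
proof (rule summableI_nonneg_bounded)
  interpret C: normed_space "c0 :: ('k, nat \<Rightarrow> 'k) nspace" by (rule normed_space_c0)
  fix N
  define u where "u n = of_real (norm (f (unit_vector n))) / f (unit_vector n)" for n
  define y where "y = (\<lambda>i. if i < N then u i else 0)"
  have yc: "y \<in> carrier c0" unfolding y_def by (rule eventually_zero_in_c0[of N]) simp
  have "nrm c0 y \<le> 1" by (rule c0_norm_le) (simp add: y_def u_def norm_divide)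
  then have "norm (f y) \<le> nrm (dual c0) f"
    using yc by (intro C.functional_le_nrm[OF f]) (simp add: unit_ball_def)
  moreover have "f y = (\<Sum>n<N. f (unit_vector n) * u n)"
    unfolding y_def by (rule c0_functional_truncation[OF f])
  moreover have "f (unit_vector n) * u n = of_real (norm (f (unit_vector n)))" for n
    by (simp add: u_def)
  ultimately have "norm (of_real (\<Sum>n<N. norm (f (unit_vector n))) :: 'k) \<le> nrm (dual c0) f"
    by simp
  then show "(\<Sum>n<N. norm (f (unit_vector n))) \<le> nrm (dual c0) f"
    unfolding norm_of_real by simp
qed simp

lemma c0_functional_sums:
  fixes f :: "(nat \<Rightarrow> 'k::scalar_field) \<Rightarrow> 'k"
  assumes f: "f \<in> carrier (dual c0)" and y: "y \<in> carrier c0"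
  shows "(\<lambda>n. f (unit_vector n) * y n) sums f y"
  unfolding sums_def
proof (rule LIMSEQ_I)
  interpret C: normed_space "c0 :: ('k, nat \<Rightarrow> 'k) nspace" by (rule normed_space_c0)
  fix e :: real assume e: "0 < e"
  define M where "M = nrm (dual c0) f + 1"
  have M: "M > 0" "nrm (dual c0) f \<le> M" using C.nrm_dual_nonneg[OF f] by (auto simp: M_def)
  have "y \<longlonglongrightarrow> 0" using y by (simp add: c0_simps)
  then obtain N0 where N0: "\<And>i. i \<ge> N0 \<Longrightarrow> norm (y i) < e / (2 * M)"
    using LIMSEQ_D[of y 0 "e / (2 * M)"] e M by auto
  have "norm ((\<Sum>n<N. f (unit_vector n) * y n) - f y) < e" if N: "N \<ge> N0" for N
  proof -
    define t where "t = (\<lambda>i. if i < N then y i else 0)"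
    have tc: "t \<in> carrier c0" unfolding t_def by (rule eventually_zero_in_c0[of N]) simp
    have "nrm c0 (t \<ominus>\<^bsub>c0\<^esub> y) \<le> e / (2 * M)"
      unfolding minus_c0[OF tc y] using N N0 e M
      by (intro c0_norm_le) (auto simp: t_def intro: less_imp_le)
    then have "nrm (dual c0) f * nrm c0 (t \<ominus>\<^bsub>c0\<^esub> y) \<le> M * (e / (2 * M))"
      using M tc y by (intro mult_mono) (auto simp: C.nrm_nonneg)
    moreover have "norm (f (t \<ominus>\<^bsub>c0\<^esub> y)) \<le> nrm (dual c0) f * nrm c0 (t \<ominus>\<^bsub>c0\<^esub> y)"
      using tc y by (intro C.functional_bound[OF f]) simp
    ultimately have "norm (f (t \<ominus>\<^bsub>c0\<^esub> y)) < e" using M e by simp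
    moreover have "f (t \<ominus>\<^bsub>c0\<^esub> y) = (\<Sum>n<N. f (unit_vector n) * y n) - f y"
      using c0_functional_truncation[OF f, of N y] tc y f by (simp add: C.dual_diff t_def)
    ultimately show ?thesis by simp
  qed
  then show "\<exists>N0. \<forall>N\<ge>N0. norm ((\<Sum>n<N. f (unit_vector n) * y n) - f y) < e" by blast
qed

section \<open>Weakly null sequences of functionals and operators into the null sequences\<close>

text \<open>
  The candidate for a weakly compact superset of the image of the ball is the image of the bidual ball
  under \<open>\<phi> \<mapsto> (\<phi> (x' n))\<^sub>n\<close>. Evaluations at points of \<open>X\<close> belong to the bidual ball, so this set is large
  enough. For weak continuity let \<open>f\<close> be a functional on \<open>c0\<close>: the values
  \<open>\<Sum>n. f (unit_vector n) * \<phi> (x' n)\<close> are uniform limits of weak* continuous functions of \<open>\<phi>\<close>, because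
  the coefficients of \<open>f\<close> are absolutely summable and the \<open>x' n\<close> are bounded.
\<close>

lemma weakly_compact_into_c0:
  fixes X :: "('k::scalar_field, 'v) nspace"
  assumes X: "banach_space X" and x': "weakly_null (dual X) x'"
  shows "weakly_compact_operator X c0 (\<lambda>x n. x' n x)"
proof -
  interpret X: banach_space X by (rule X)
  interpret D: normed_space "dual X" by (rule X.normed_space_dual)
  interpret C: normed_space "c0 :: ('k, nat \<Rightarrow> 'k) nspace" by (rule normed_space_c0)
  have xd: "x' n \<in> carrier (dual X)" for n
    using x' by (auto simp: weakly_null_def)
  have bidual: "(\<lambda>n. \<phi> (x' n)) \<longlonglongrightarrow> 0" if "\<phi> \<in> carrier (dual (dual X))" for \<phi>
    using x' that by (auto simp: D.weakly_null_iff)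
  have null: "(\<lambda>n. x' n x) \<longlonglongrightarrow> 0" if "x \<in> carrier X" for x
    using bidual[OF X.evaluation_in_bidual(1)[OF that]] xd by simp
  have "\<exists>M. \<forall>n. nrm (dual X) (x' n) \<le> M"
  proof (rule X.uniform_boundedness[OF X.complete xd])
    fix x assume "x \<in> carrier X"
    then show "\<exists>B. \<forall>n. norm (x' n x) \<le> B"
      using convergent_imp_bounded[OF null] by (auto simp: bounded_iff)
  qed
  then obtain M where M: "\<And>n. nrm (dual X) (x' n) \<le> M" by blast
  have op: "operator X c0 (\<lambda>x n. x' n x)"
  proof (rule operatorI[OF X.normed_space_axioms normed_space_c0, where M = M])
    fix x assume x: "x \<in> carrier X"
    show "nrm c0 (\<lambda>n. x' n x) \<le> M * nrm X x"
      using X.functional_bound[OF xd x] mult_right_mono[OF M X.nrm_nonneg[OF x]]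
      by (intro c0_norm_le) (rule order_trans)
  qed (use null in \<open>auto simp: c0_simps X.dual_add[OF xd] X.dual_smult[OF xd]\<close>)
  define B where "B = unit_ball (dual (dual X))"
  define Z where "Z = subtopology D.pointwise B"
  define g where "g \<phi> = (\<lambda>n. \<phi> (x' n))" for \<phi> :: "('v \<Rightarrow> 'k) \<Rightarrow> 'k"
  have BD: "\<phi> \<in> carrier (dual (dual X))" if "\<phi> \<in> B" for \<phi>
    using that by (simp add: B_def unit_ball_def)
  have "compactin D.pointwise B" unfolding B_def by (rule D.banach_alaoglu)
  then have Zc: "compactin Z B" and ZB: "topspace Z = B"
    unfolding Z_def using compactin_subset_topspace[of D.pointwise B]
    by (auto simp: compactin_subtopology topspace_subtopology)
  have gc: "g \<phi> \<in> carrier c0" if "\<phi> \<in> B" for \<phi>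
    using bidual[OF BD[OF that]] by (simp add: g_def c0_simps)
  have cont: "continuous_map Z (weak_topology c0) g"
  proof (rule C.continuous_map_into_weak)
    fix f :: "(nat \<Rightarrow> 'k) \<Rightarrow> 'k" assume f: "f \<in> carrier (dual c0)"
    define s where "s N \<phi> = (\<Sum>n<N. f (unit_vector n) * \<phi> (x' n))" for N and \<phi> :: "('v \<Rightarrow> 'k) \<Rightarrow> 'k"
    have "uniform_limit B s (\<lambda>\<phi>. \<Sum>n. f (unit_vector n) * \<phi> (x' n)) sequentially"
      unfolding s_def
    proof (rule Weierstrass_m_test)
      show "summable (\<lambda>n. norm (f (unit_vector n)) * M)"
        using c0_functional_summable[OF f] by (rule summable_mult2)
      fix n \<phi> assume "\<phi> \<in> B"
      then have "norm (\<phi> (x' n)) \<le> M"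
        using D.unit_ball_dual_iff xd M[of n] by (auto simp: B_def intro: order_trans)
      then show "norm (f (unit_vector n) * \<phi> (x' n)) \<le> norm (f (unit_vector n)) * M"
        by (simp add: norm_mult mult_left_mono)
    qed
    moreover have "(\<Sum>n. f (unit_vector n) * \<phi> (x' n)) = f (g \<phi>)" if "\<phi> \<in> B" for \<phi>
      using c0_functional_sums[OF f gc[OF that]] by (simp add: sums_iff g_def)
    ultimately have lim: "uniform_limit B s (\<lambda>\<phi>. f (g \<phi>)) sequentially"
      by (simp cong: uniform_limit_cong')
    have coord: "continuous_map Z euclidean (\<lambda>\<phi>. c * \<phi> (x' n))" for c n
    proof -
      have "continuous_map Z euclidean (\<lambda>\<phi>. \<phi> (x' n))"
        unfolding Z_def by (intro continuous_map_from_subtopology continuous_map_product_projection xd)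
      from continuous_map_compose[OF this, of euclidean "\<lambda>z. c * z"]
      show ?thesis by (simp add: o_def continuous_intros)
    qed
    have "continuous_map Z Met_TC.mtopology (\<lambda>\<phi>. f (g \<phi>))"
    proof (rule Met_TC.continuous_map_uniform_limit[where f = s and F = sequentially])
      show "\<forall>\<^sub>F N in sequentially. continuous_map Z Met_TC.mtopology (s N)"
        unfolding s_def mtopology_is_euclidean
        by (intro always_eventually allI continuous_map_sum coord) simp
      show "\<forall>\<^sub>F N in sequentially. \<forall>\<phi>\<in>topspace Z. f (g \<phi>) \<in> UNIV \<and> dist (s N \<phi>) (f (g \<phi>)) < e"
        if "0 < e" for e
        using uniform_limitD[OF lim that] by (simp add: ZB)
    qed simp
    then show "continuous_map Z euclidean (\<lambda>\<phi>. f (g \<phi>))" by simp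
  qed (simp add: ZB gc)
  have "compactin (weak_topology c0) (g ` B)"
    by (rule image_compactin[OF Zc cont])
  moreover have "(\<lambda>x n. x' n x) ` unit_ball X \<subseteq> g ` B"
  proof clarify
    fix x assume x: "x \<in> unit_ball X"
    then have xc: "x \<in> carrier X" by (simp add: unit_ball_def)
    show "(\<lambda>n. x' n x) \<in> g ` B"
      using X.evaluation_in_bidual(2)[OF xc x] xd
      by (intro image_eqI[of _ _ "\<lambda>f\<in>carrier (dual X). f x"]) (auto simp: g_def B_def)
  qed
  ultimately have "relatively_weakly_compact c0 ((\<lambda>x n. x' n x) ` unit_ball X)"
    by (rule C.relatively_weakly_compact_subset[OF Hausdorff_weak_c0])
  with op show ?thesis by (simp add: weakly_compact_operator_def)
qed

section \<open>Isometric copies\<close>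

text \<open>
  The structure of \<open>Z\<close> is transported along \<open>j\<close>, which is meant to be injective on the carrier.
\<close>

definition isometric_copy :: "('v \<Rightarrow> 'w) \<Rightarrow> ('k, 'v) nspace \<Rightarrow> ('k, 'w) nspace" where
  "isometric_copy j Z = (let i = inv_into (carrier Z) j in
     \<lparr>carrier = j ` carrier Z, mult = undefined, one = undefined, zero = j \<zero>\<^bsub>Z\<^esub>,
      add = (\<lambda>u v. j (i u \<oplus>\<^bsub>Z\<^esub> i v)), smult = (\<lambda>a u. j (a \<odot>\<^bsub>Z\<^esub> i u)),
      nrm = (\<lambda>u. nrm Z (i u))\<rparr>)"

context normed_space
begin

context
  fixes j :: "'v \<Rightarrow> 'w"
  assumes inj: "inj_on j (carrier X)"
begin

lemma isometric_copy_simps: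
  "carrier (isometric_copy j X) = j ` carrier X" "\<zero>\<^bsub>isometric_copy j X\<^esub> = j \<zero>\<^bsub>X\<^esub>"
  "x \<in> carrier X \<Longrightarrow> y \<in> carrier X \<Longrightarrow> j x \<oplus>\<^bsub>isometric_copy j X\<^esub> j y = j (x \<oplus> y)"
  "x \<in> carrier X \<Longrightarrow> a \<odot>\<^bsub>isometric_copy j X\<^esub> j x = j (a \<odot> x)"
  "x \<in> carrier X \<Longrightarrow> nrm (isometric_copy j X) (j x) = nrm X x"
  using inj by (simp_all add: isometric_copy_def Let_def)

lemma normed_space_isometric_copy: "normed_space (isometric_copy j X)"
  by (rule normed_spaceI)
    (auto simp: isometric_copy_simps a_assoc a_comm a_lcomm add_smult smult_add mult_smult nrm_nonneg
      nrm_eq_0_iff nrm_smult nrm_triangle)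

lemma isometric_copy_operators:
  "operator X (isometric_copy j X) j"
  "operator (isometric_copy j X) X (inv_into (carrier X) j)"
  by (rule operatorI[where M = 1],
      auto simp: normed_space_isometric_copy normed_space_axioms isometric_copy_simps inj)+

lemma banach_space_isometric_copy:
  assumes "metric.mcomplete"
  shows "banach_space (isometric_copy j X)"
proof -
  interpret C: normed_space "isometric_copy j X" by (rule normed_space_isometric_copy)
  have dist: "ndist (isometric_copy j X) (j x) (j y) = ndist X x y"
    if "x \<in> carrier X" "y \<in> carrier X" for x y
    using that by (simp add: ndist_def C.minus_eq_smult minus_eq_smult isometric_copy_simps)
  have "\<exists>y. limitin (norm_topology (isometric_copy j X)) s y sequentially"
    if s: "C.metric.MCauchy s" for s :: "nat \<Rightarrow> 'w"
  proof -
    have "s n \<in> carrier (isometric_copy j X)" for n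
      using s unfolding C.metric.MCauchy_def by blast
    then have range: "s n \<in> j ` carrier X" for n
      by (simp add: isometric_copy_simps)
    define t where "t n = inv_into (carrier X) j (s n)" for n
    have t: "t n \<in> carrier X" and st: "s n = j (t n)" for n
      unfolding t_def using inv_into_into[OF range] f_inv_into_f[OF range] by simp_all
    have "metric.MCauchy t"
      using s t unfolding C.metric.MCauchy_def metric.MCauchy_def by (auto simp: st dist)
    then obtain x where x: "limitin (norm_topology X) t x sequentially"
      using assms unfolding metric.mcomplete_def by blast
    then have xc: "x \<in> carrier X" by (auto simp: limitin_def)
    have "limitin (norm_topology (isometric_copy j X)) s (j x) sequentially"
      using x t xc unfolding C.metric.limitin_metric metric.limitin_metric
      by (simp add: st dist isometric_copy_simps)
    then show ?thesis by blast
  qed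
  then have "C.metric.mcomplete" unfolding C.metric.mcomplete_def by blast
  then show ?thesis
    by (intro banach_space.intro banach_space_axioms.intro normed_space_isometric_copy)
qed

lemma weakly_compact_operator_isometric_copy:
  assumes W: "normed_space W" and T: "weakly_compact_operator W X T"
    and H: "Hausdorff_space (weak_topology X)"
  shows "weakly_compact_operator W (isometric_copy j X) (\<lambda>w. j (T w))"
proof -
  interpret C: normed_space "isometric_copy j X" by (rule normed_space_isometric_copy)
  let ?K = "weak_topology X closure_of (T ` unit_ball W)"
  have op: "operator W X T" and sub: "T ` unit_ball W \<subseteq> carrier X" and K: "compactin (weak_topology X) ?K"
    using T by (auto simp: weakly_compact_operator_def relatively_weakly_compact_def)
  have jc: "continuous_map (weak_topology X) (weak_topology (isometric_copy j X)) j"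
    and ic: "continuous_map (weak_topology (isometric_copy j X)) (weak_topology X) (inv_into (carrier X) j)"
    using operator_weakly_continuous normed_space_axioms normed_space_isometric_copy
      isometric_copy_operators by blast+
  have "Hausdorff_space (weak_topology (isometric_copy j X))"
    by (rule Hausdorff_space_injective_preimage[OF H ic])
      (simp add: isometric_copy_simps inj_on_inv_into)
  moreover have "compactin (weak_topology (isometric_copy j X)) (j ` ?K)"
    by (rule image_compactin[OF K jc])
  moreover have "(\<lambda>w. j (T w)) ` unit_ball W \<subseteq> j ` ?K"
    using closure_of_subset[of "T ` unit_ball W" "weak_topology X"] sub by auto
  ultimately have "relatively_weakly_compact (isometric_copy j X) ((\<lambda>w. j (T w)) ` unit_ball W)"
    by (rule C.relatively_weakly_compact_subset)
  then show ?thesis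
    using operator_comp[OF op isometric_copy_operators(1)]
    by (simp add: weakly_compact_operator_def)
qed

end

end

section \<open>The equivalences\<close>

text \<open>
  The common form of the gliding hump arguments below: only consecutive members of the
  subsequence have to be related.
\<close>

lemma successive_choice:
  assumes "\<And>k::nat. \<exists>m>k. P k m"
  obtains s :: "nat \<Rightarrow> nat" where "strict_mono s" "\<And>i. P (s i) (s (Suc i))"
proof -
  obtain nxt where nxt: "\<And>k. nxt k > k" "\<And>k. P k (nxt k)" using assms by metis
  show thesis
    by (rule that[of "\<lambda>i. (nxt ^^ i) 0"]) (auto simp: strict_mono_Suc_iff nxt)
qed

lemma DPP_imp_converging_c0:
  fixes X :: "('k::scalar_field, 'v) nspace"
  assumes p: "0 < p" and X: "normed_space X" and DPP: "DPP TYPE('u) p X"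
    and T: "weakly_compact_operator X c0 T"
  shows "unconditionally_p_converging p X c0 T"
proof -
  interpret C: banach_space "c0 :: ('k, nat \<Rightarrow> 'k) nspace" by (rule banach_space_c0)
  define j where "j = (Inl :: (nat \<Rightarrow> 'k) \<Rightarrow> (nat \<Rightarrow> 'k) + 'u)"
  define Y where "Y = isometric_copy j (c0 :: ('k, nat \<Rightarrow> 'k) nspace)"
  have inj: "inj_on j (carrier c0)" by (simp add: j_def)
  have "banach_space Y"
    unfolding Y_def by (rule C.banach_space_isometric_copy[OF inj C.complete])
  moreover have "weakly_compact_operator X Y (\<lambda>x. j (T x))"
    unfolding Y_def by (rule C.weakly_compact_operator_isometric_copy[OF inj X T Hausdorff_weak_c0])
  ultimately have conv: "unconditionally_p_converging p X Y (\<lambda>x. j (T x))"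
    using DPP by (auto simp: DPP_def)
  have Tc: "T x \<in> carrier c0" if "x \<in> carrier X" for x
    using T that by (auto simp: weakly_compact_operator_def operator_def)
  show ?thesis
    unfolding unconditionally_p_converging_def
  proof (intro allI impI)
    fix x assume x: "weakly_p_summable p X x"
    then have xc: "x n \<in> carrier X" for n by (auto simp: weakly_p_summable_def)
    have "unconditionally_p_summable p Y (\<lambda>n. j (T (x n)))"
      using conv x by (simp add: unconditionally_p_converging_def)
    then have "unconditionally_p_summable p c0 (\<lambda>n. inv_into (carrier c0) j (j (T (x n))))"
      unfolding Y_def
      by (rule unconditionally_p_summable_contraction[OF C.normed_space_isometric_copy[OF inj]
            normed_space_c0 p C.isometric_copy_operators(2)[OF inj], rotated])
        (auto simp: C.isometric_copy_simps[OF inj] inj)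
    then show "unconditionally_p_summable p c0 (\<lambda>n. T (x n))"
      using Tc[OF xc] inj by simp
  qed
qed

text \<open>
  The n-th coordinate functional of \<open>c0\<close>, applied to the image of \<open>x n\<close>, gives \<open>x' n (x n)\<close>, and
  tails that are uniformly small over the dual ball control it.
\<close>

lemma converging_c0_imp_null:
  fixes X :: "('k::scalar_field, 'v) nspace"
  assumes p: "0 < p" and X: "banach_space X"
    and conv: "\<And>T. weakly_compact_operator X c0 T \<Longrightarrow> unconditionally_p_converging p X c0 T"
    and x: "weakly_p_summable p X x" and x': "weakly_null (dual X) x'"
  shows "(\<lambda>n. x' n (x n)) \<longlonglongrightarrow> 0"
proof (rule LIMSEQ_I)
  interpret C: normed_space "c0 :: ('k, nat \<Rightarrow> 'k) nspace" by (rule normed_space_c0)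
  fix e :: real assume e: "0 < e"
  have "unconditionally_p_summable p c0 (\<lambda>n i. x' i (x n))"
    using conv[OF weakly_compact_into_c0[OF X x']] x by (simp add: unconditionally_p_converging_def)
  then have c: "range (\<lambda>n i. x' i (x n)) \<subseteq> carrier c0"
    and tails: "\<And>e. e > 0 \<Longrightarrow> \<exists>m. \<forall>f\<in>unit_ball (dual c0). \<forall>N.
      (\<Sum>n<N. norm (f (\<lambda>i. x' i (x (n + m)))) powr p) \<le> e"
    by (auto simp: C.unconditionally_p_summable_iff[OF p] C.weakly_p_summable_iff[OF p])
  have "0 < (e / 2) powr p" using e by simp
  from tails[OF this] obtain m where m: "\<And>f N. f \<in> unit_ball (dual c0) \<Longrightarrow>
      (\<Sum>n<N. norm (f (\<lambda>i. x' i (x (n + m)))) powr p) \<le> (e / 2) powr p"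
    by blast
  have "norm (x' n (x n)) < e" if n: "n \<ge> m" for n
  proof -
    let ?f = "\<lambda>y\<in>carrier (c0 :: ('k, nat \<Rightarrow> 'k) nspace). y n"
    have "norm (?f (\<lambda>i. x' i (x (n - m + m)))) powr p
        \<le> (\<Sum>k<Suc (n - m). norm (?f (\<lambda>i. x' i (x (k + m)))) powr p)"
      by (rule member_le_sum) auto
    also have "\<dots> \<le> (e / 2) powr p" by (rule m[OF c0_coordinate_functional])
    finally have "norm (x' n (x n)) powr p \<le> (e / 2) powr p"
      using n c by (simp add: image_subset_iff)
    from powr_mono2[OF _ _ this, of "1 / p"] show ?thesis
      using p e by (simp add: powr_powr)
  qed
  then show "\<exists>m. \<forall>n\<ge>m. norm (x' n (x n) - 0) < e" by auto
qed

context normed_space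
begin

text \<open>
  For a fixed functional the pairing with later members of \<open>x\<close> tends to 0. So along a sparse
  subsequence the differences of consecutive functionals, which are weakly null, pair with \<open>x\<close> almost
  as the functionals themselves do.
\<close>

lemma null_imp_weakly_Cauchy_null:
  assumes p: "0 < p"
    and null: "\<And>x x'. weakly_p_summable p X x \<Longrightarrow> weakly_null (dual X) x' \<Longrightarrow> (\<lambda>n. x' n (x n)) \<longlonglongrightarrow> 0"
    and x: "weakly_p_summable p X x" and x': "weakly_Cauchy (dual X) x'"
  shows "(\<lambda>n. x' n (x n)) \<longlonglongrightarrow> 0"
proof (rule ccontr)
  interpret D: normed_space "dual X" by (rule normed_space_dual)
  assume "\<not> ?thesis"
  then obtain e and r :: "nat \<Rightarrow> nat" where e: "e > 0" and r: "strict_mono r"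
    and far: "\<And>k. e \<le> dist (x' (r k) (x (r k))) 0"
    by (rule not_tendsto_subsequence) blast
  have xc: "x n \<in> carrier X" for n using x by (auto simp: weakly_p_summable_def)
  have xd: "x' n \<in> carrier (dual X)" for n using x' by (auto simp: weakly_Cauchy_def)
  have "\<exists>m>k. norm (x' (r k) (x (r m))) < e / 2" for k
  proof -
    have "(\<lambda>m. x' (r k) (x (r m))) \<longlonglongrightarrow> 0"
      using weakly_p_summable_imp_tendsto_0[OF p weakly_p_summable_subseq[OF p x r] xd] .
    then obtain N where N: "\<And>m. m \<ge> N \<Longrightarrow> norm (x' (r k) (x (r m))) < e / 2"
      using LIMSEQ_D[of _ 0 "e / 2"] e by auto
    then show ?thesis by (intro exI[of _ "max N (Suc k)"]) auto
  qed
  then obtain s where s: "strict_mono s" and small: "\<And>i. norm (x' (r (s i)) (x (r (s (Suc i))))) < e / 2"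
    by (rule successive_choice[of "\<lambda>k m. norm (x' (r k) (x (r m))) < e / 2"]) blast
  define t where "t = (\<lambda>i. r (s i))"
  have t: "strict_mono t" "strict_mono (\<lambda>i. t (Suc i))"
    using r s by (auto simp: t_def strict_mono_def)
  define w where "w i = x' (t (Suc i)) \<ominus>\<^bsub>dual X\<^esub> x' (t i)" for i
  have "weakly_null (dual X) w"
    unfolding D.weakly_null_iff
  proof (intro conjI ballI)
    show "range w \<subseteq> carrier (dual X)" using xd by (auto simp: w_def)
    fix \<phi> assume \<phi>: "\<phi> \<in> carrier (dual (dual X))"
    then have "convergent (\<lambda>n. \<phi> (x' n))"
      using x' by (simp add: weakly_Cauchy_def Cauchy_convergent)
    then obtain L where L: "(\<lambda>n. \<phi> (x' n)) \<longlonglongrightarrow> L" by (auto simp: convergent_def)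
    have "(\<lambda>i. \<phi> (x' (t (Suc i))) - \<phi> (x' (t i))) \<longlonglongrightarrow> L - L"
      using LIMSEQ_subseq_LIMSEQ[OF L t(2)] LIMSEQ_subseq_LIMSEQ[OF L t(1)]
      by (intro tendsto_diff) (simp_all add: o_def)
    then show "(\<lambda>i. \<phi> (w i)) \<longlonglongrightarrow> 0"
      using \<phi> xd by (simp add: w_def D.dual_diff)
  qed
  then have "(\<lambda>i. w i (x (t (Suc i)))) \<longlonglongrightarrow> 0"
    by (rule null[OF weakly_p_summable_subseq[OF p x t(2)]])
  moreover have "e / 2 \<le> norm (w i (x (t (Suc i))))" for i
  proof -
    have "w i (x (t (Suc i))) = x' (t (Suc i)) (x (t (Suc i))) - x' (t i) (x (t (Suc i)))"
      using xc xd by (simp add: w_def D.minus_eq_smult)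
    moreover have "e \<le> norm (x' (t (Suc i)) (x (t (Suc i))))"
      using far[of "s (Suc i)"] by (simp add: t_def)
    moreover have "norm (x' (t i) (x (t (Suc i)))) < e / 2"
      using small[of i] by (simp add: t_def)
    ultimately show ?thesis
      using norm_triangle_ineq2[of "x' (t (Suc i)) (x (t (Suc i)))" "x' (t i) (x (t (Suc i)))"] by simp
  qed
  ultimately show False
    using LIMSEQ_D[of "\<lambda>i. w i (x (t (Suc i)))" 0 "e / 2"] e by (auto simp: not_less[symmetric])
qed

text \<open>
  The same argument with exchanged roles: for a fixed vector the pairing with later functionals tends
  to 0, and the differences are taken of the vectors.
\<close>

lemma null_imp_p_Cauchy_null:
  assumes p: "0 < p"
    and null: "\<And>x x'. weakly_p_summable p X x \<Longrightarrow> weakly_null (dual X) x' \<Longrightarrow> (\<lambda>n. x' n (x n)) \<longlonglongrightarrow> 0"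
    and x: "weakly_p_Cauchy p X x" and x': "weakly_null (dual X) x'"
  shows "(\<lambda>n. x' n (x n)) \<longlonglongrightarrow> 0"
proof (rule ccontr)
  interpret D: normed_space "dual X" by (rule normed_space_dual)
  assume "\<not> ?thesis"
  then obtain e and r :: "nat \<Rightarrow> nat" where e: "e > 0" and r: "strict_mono r"
    and far: "\<And>k. e \<le> dist (x' (r k) (x (r k))) 0"
    by (rule not_tendsto_subsequence) blast
  have xc: "x n \<in> carrier X" for n using x by (auto simp: weakly_p_Cauchy_def)
  have xd: "x' n \<in> carrier (dual X)" for n using x' by (auto simp: weakly_null_def)
  have lim: "(\<lambda>n. \<phi> (x' n)) \<longlonglongrightarrow> 0" if "\<phi> \<in> carrier (dual (dual X))" for \<phi>
    using x' that by (simp add: D.weakly_null_iff)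
  have "\<exists>m>k. norm (x' (r m) (x (r k))) < e / 2" for k
  proof -
    have "(\<lambda>n. x' n (x (r k))) \<longlonglongrightarrow> 0"
      using lim[OF evaluation_in_bidual(1)[OF xc]] xd by simp
    then have "(\<lambda>m. x' (r m) (x (r k))) \<longlonglongrightarrow> 0"
      using LIMSEQ_subseq_LIMSEQ[OF _ r] by (auto simp: o_def)
    then obtain N where N: "\<And>m. m \<ge> N \<Longrightarrow> norm (x' (r m) (x (r k))) < e / 2"
      using LIMSEQ_D[of _ 0 "e / 2"] e by auto
    then show ?thesis by (intro exI[of _ "max N (Suc k)"]) auto
  qed
  then obtain s where s: "strict_mono s" and small: "\<And>i. norm (x' (r (s (Suc i))) (x (r (s i)))) < e / 2"
    by (rule successive_choice[of "\<lambda>k m. norm (x' (r m) (x (r k))) < e / 2"]) blast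
  define t where "t = (\<lambda>i. r (s i))"
  have t: "strict_mono t" "strict_mono (\<lambda>i. t (Suc i))"
    using r s by (auto simp: t_def strict_mono_def)
  have z: "weakly_p_summable p X (\<lambda>i. x (t (Suc i)) \<ominus> x (t i))"
    using x t unfolding weakly_p_Cauchy_def by blast
  have "weakly_null (dual X) (\<lambda>i. x' (t (Suc i)))"
    unfolding D.weakly_null_iff using xd LIMSEQ_subseq_LIMSEQ[OF lim t(2)] by (auto simp: o_def)
  from null[OF z this]
  have "(\<lambda>i. x' (t (Suc i)) (x (t (Suc i)) \<ominus> x (t i))) \<longlonglongrightarrow> 0" .
  moreover have "e / 2 \<le> norm (x' (t (Suc i)) (x (t (Suc i)) \<ominus> x (t i)))" for i
  proof -
    have "e \<le> norm (x' (t (Suc i)) (x (t (Suc i))))"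
      using far[of "s (Suc i)"] by (simp add: t_def)
    moreover have "norm (x' (t (Suc i)) (x (t i))) < e / 2"
      using small[of i] by (simp add: t_def)
    ultimately show ?thesis
      using norm_triangle_ineq2[of "x' (t (Suc i)) (x (t (Suc i)))" "x' (t (Suc i)) (x (t i))"] xc xd
      by (simp add: dual_diff)
  qed
  ultimately show False
    using LIMSEQ_D[of "\<lambda>i. x' (t (Suc i)) (x (t (Suc i)) \<ominus> x (t i))" 0 "e / 2"] e
    by (auto simp: not_less[symmetric])
qed

lemma weakly_p_summable_imp_p_Cauchy:
  assumes p: "0 < p" and x: "weakly_p_summable p X x"
  shows "weakly_p_Cauchy p X x"
proof -
  have "range x \<subseteq> carrier X" using x by (simp add: weakly_p_summable_def)
  then show ?thesis
    using weakly_p_summable_diff[OF p weakly_p_summable_subseq[OF p x] weakly_p_summable_subseq[OF p x]]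
    by (auto simp: weakly_p_Cauchy_def)
qed

text \<open>
  If the tails are not uniformly small, there are disjoint blocks on each of which some \<open>f i\<close> has an
  \<open>l_p\<close> norm bounded below. The coefficients on a block are those of the vector in the unit ball of
  \<open>l_q\<close> at which this norm is attained.
\<close>

lemma not_converging_imp_blocks:
  assumes p: "1 < p" and Y: "normed_space Y" and T: "operator X Y T"
    and x: "weakly_p_summable p X x" and not: "\<not> unconditionally_p_summable p Y (\<lambda>n. T (x n))"
  obtains e z f where "e > 0" "weakly_p_summable p X z" "\<And>i. f i \<in> unit_ball (dual Y)"
    "\<And>i::nat. e \<le> norm (f i (T (z i)))"
proof -
  interpret Y: normed_space Y by (rule Y)
  have p0: "0 < p" using p by simp
  have xc: "x n \<in> carrier X" for n using x by (auto simp: weakly_p_summable_def)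
  obtain e where e: "e > 0" and big: "\<And>m. \<exists>f\<in>unit_ball (dual Y). \<exists>N.
      e < (\<Sum>n<N. norm (f (T (x (n + m)))) powr p)"
    using not weakly_p_summable_operator[OF normed_space_axioms Y p0 T x]
    by (auto simp: Y.unconditionally_p_summable_iff[OF p0] not_le)
  have "\<exists>m>k. \<exists>f\<in>unit_ball (dual Y). e < (\<Sum>n\<in>{k..<m}. norm (f (T (x n))) powr p)" for k
  proof -
    obtain f N where f: "f \<in> unit_ball (dual Y)" and N: "e < (\<Sum>n<N. norm (f (T (x (n + k)))) powr p)"
      using big[of k] by blast
    have "(\<Sum>n<N. norm (f (T (x (n + k)))) powr p) = (\<Sum>n\<in>{k..<N + k}. norm (f (T (x n))) powr p)"
      by (rule sum.reindex_bij_witness[of _ "\<lambda>n. n - k" "\<lambda>n. n + k"]) auto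
    moreover have "N \<noteq> 0" using N e by (intro notI) simp
    ultimately show ?thesis using f N by (intro exI[of _ "N + k"]) auto
  qed
  then obtain k where k: "strict_mono k" and
    "\<And>i. \<exists>f\<in>unit_ball (dual Y). e < (\<Sum>n\<in>{k i..<k (Suc i)}. norm (f (T (x n))) powr p)"
    by (rule successive_choice[of "\<lambda>k m. \<exists>f\<in>unit_ball (dual Y). e < (\<Sum>n\<in>{k..<m}. norm (f (T (x n))) powr p)"]) blast
  then obtain f where f: "\<And>i. f i \<in> unit_ball (dual Y)"
    and fe: "\<And>i. e < (\<Sum>n\<in>{k i..<k (Suc i)}. norm (f i (T (x n))) powr p)"
    by metis
  define S where "S i = (\<Sum>n\<in>{k i..<k (Suc i)}. norm (f i (T (x n))) powr p)" for i
  have S: "S i > 0" for i using fe[of i] e by (simp add: S_def)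
  \<comment> \<open>For \<open>b = f i (T (x n))\<close> this is \<open>norm b powr (p - 2)\<close> times the conjugate of \<open>b\<close>, and 0 if \<open>b = 0\<close>;
    the power of \<open>S i\<close> normalises the \<open>l_q\<close> norm over the block to 1.\<close>
  define a where "a i n = of_real (norm (f i (T (x n))) powr p * S i powr (1 / p - 1)) / f i (T (x n))" for i n
  have na: "norm (a i n) powr (p / (p - 1)) = norm (f i (T (x n))) powr p / S i" for i n
  proof (cases "f i (T (x n)) = 0")
    case False
    have "norm (a i n) = norm (f i (T (x n))) powr (p - 1) * S i powr (1 / p - 1)"
      using False by (simp add: a_def norm_divide norm_mult powr_diff del: of_real_mult)
    also have "\<dots> powr (p / (p - 1)) = norm (f i (T (x n))) powr p * S i powr ((1 / p - 1) * (p / (p - 1)))"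
      using p by (simp add: powr_mult powr_powr)
    also have "(1 / p - 1) * (p / (p - 1)) = -1" using p by (simp add: field_simps)
    finally show ?thesis using S[of i] by (simp add: powr_minus field_simps)
  qed (simp add: a_def)
  have unit: "(\<Sum>n\<in>{k i..<k (Suc i)}. norm (a i n) powr (p / (p - 1))) \<le> 1" for i
    using S[of i] by (simp add: na S_def flip: sum_divide_distrib)
  define z where "z i = (\<Oplus>\<^bsub>X\<^esub>n\<in>{k i..<k (Suc i)}. a i n \<odot> x n)" for i
  have z: "weakly_p_summable p X z"
    unfolding z_def by (rule weakly_p_summable_blocks[OF p x k unit])
  have "e powr (1 / p) \<le> norm (f i (T (z i)))" for i
  proof -
    have fd: "f i \<in> carrier (dual Y)" using f by (simp add: unit_ball_def)
    define h where "h = (\<lambda>x\<in>carrier X. f i (T x))"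
    have h: "h \<in> carrier (dual X)" unfolding h_def by (rule dual_compose[OF Y T fd])
    have zc: "z i \<in> carrier X" using z by (auto simp: weakly_p_summable_def)
    have "f i (T (z i)) = h (z i)" using zc by (simp add: h_def)
    also have "\<dots> = (\<Sum>n\<in>{k i..<k (Suc i)}. a i n * h (x n))"
      unfolding z_def by (rule dual_finsum[OF h]) (use xc in auto)
    also have "\<dots> = (\<Sum>n\<in>{k i..<k (Suc i)}. of_real (norm (f i (T (x n))) powr p * S i powr (1 / p - 1)))"
      using xc by (intro sum.cong) (auto simp: h_def a_def)
    also have "\<dots> = of_real (S i * S i powr (1 / p - 1))"
      by (simp add: S_def sum_distrib_right)
    also have "S i * S i powr (1 / p - 1) = S i powr (1 / p)"
      using S[of i] by (simp add: powr_diff)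
    finally have "norm (f i (T (z i))) = S i powr (1 / p)" by simp
    then show ?thesis
      using p e fe[of i] by (simp add: S_def powr_mono2)
  qed
  then show thesis
    using e z f by (intro that[of "e powr (1 / p)" z f]) auto
qed

lemma weakly_Cauchy_null_imp_converging:
  assumes p: "1 < p" and Y: "normed_space Y" and T: "weakly_compact_operator X Y T"
    and null: "\<And>x x'. weakly_p_summable p X x \<Longrightarrow> weakly_Cauchy (dual X) x' \<Longrightarrow> (\<lambda>n. x' n (x n)) \<longlonglongrightarrow> 0"
  shows "unconditionally_p_converging p X Y T"
  unfolding unconditionally_p_converging_def
proof (intro allI impI, rule ccontr)
  have p0: "0 < p" using p by simp
  have op: "operator X Y T" using T by (simp add: weakly_compact_operator_def)
  fix x assume "weakly_p_summable p X x" "\<not> unconditionally_p_summable p Y (\<lambda>n. T (x n))"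
  then obtain e z f where e: "e > 0" and z: "weakly_p_summable p X z"
    and f: "\<And>i. f i \<in> unit_ball (dual Y)" and far: "\<And>i::nat. e \<le> norm (f i (T (z i)))"
    by (rule not_converging_imp_blocks[OF p Y op]) blast
  have zc: "z i \<in> carrier X" for i using z by (auto simp: weakly_p_summable_def)
  obtain r where r: "strict_mono r" and c: "weakly_Cauchy (dual X) (\<lambda>n. \<lambda>x\<in>carrier X. f (r n) (T x))"
    by (rule weakly_compact_adjoint[where f = f, OF normed_space_axioms Y T f]) blast
  have "(\<lambda>n. (\<lambda>x\<in>carrier X. f (r n) (T x)) (z (r n))) \<longlonglongrightarrow> 0"
    by (rule null[OF weakly_p_summable_subseq[OF p0 z r] c])
  then have "(\<lambda>n. f (r n) (T (z (r n)))) \<longlonglongrightarrow> 0" using zc by simp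
  then show False
    using LIMSEQ_D[of "\<lambda>n. f (r n) (T (z (r n)))" 0 e] e far by (auto simp: not_less[symmetric])
qed

end

theorem theorem3p2:
  fixes p :: real and X :: "('k::scalar_field, 'v) nspace"
  assumes "1 < p" and "banach_space X"
  shows
    "(DPP TYPE('u) p X \<longleftrightarrow>
        (\<forall>T. weakly_compact_operator X c0 T \<longrightarrow> unconditionally_p_converging p X c0 T)) \<and>
     (DPP TYPE('u) p X \<longleftrightarrow>
        (\<forall>x x'. weakly_p_Cauchy p X x \<longrightarrow> weakly_null (dual X) x' \<longrightarrow>
           (\<lambda>n. x' n (x n)) \<longlonglongrightarrow> 0)) \<and>
     (DPP TYPE('u) p X \<longleftrightarrow>
        (\<forall>x x'. weakly_p_summable p X x \<longrightarrow> weakly_null (dual X) x' \<longrightarrow>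
           (\<lambda>n. x' n (x n)) \<longlonglongrightarrow> 0)) \<and>
     (DPP TYPE('u) p X \<longleftrightarrow>
        (\<forall>x x'. weakly_p_summable p X x \<longrightarrow> weakly_Cauchy (dual X) x' \<longrightarrow>
           (\<lambda>n. x' n (x n)) \<longlonglongrightarrow> 0))"
    (is "(?dpp \<longleftrightarrow> ?c0) \<and> (?dpp \<longleftrightarrow> ?pCauchy) \<and> (?dpp \<longleftrightarrow> ?null) \<and> (?dpp \<longleftrightarrow> ?Cauchy)")
proof -
  interpret X: banach_space X by (rule assms(2))
  interpret D: normed_space "dual X" by (rule X.normed_space_dual)
  have p: "0 < p" using assms(1) by simp
  have "?dpp \<Longrightarrow> ?c0"
    using DPP_imp_converging_c0[OF p X.normed_space_axioms] by blast
  moreover have "?c0 \<Longrightarrow> ?null"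
    using converging_c0_imp_null[OF p assms(2)] by blast
  moreover have "?null \<Longrightarrow> ?Cauchy"
    using X.null_imp_weakly_Cauchy_null[OF p] by blast
  moreover have "?Cauchy \<Longrightarrow> ?dpp"
    using X.weakly_Cauchy_null_imp_converging[OF assms(1)]
    by (auto simp: DPP_def banach_space_def)
  moreover have "?null \<Longrightarrow> ?pCauchy"
    using X.null_imp_p_Cauchy_null[OF p] by blast
  moreover have "?pCauchy \<Longrightarrow> ?null"
    using X.weakly_p_summable_imp_p_Cauchy[OF p] by blast
  ultimately show ?thesis by argo
qed

end
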